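(* Let $G$ be a $q$-manifold (a finite abstract simplicial complex as defined in the context) with vertex set $V(G)$, and let $k\ge 0$. Let $g:V(G)\to K_k=\{0,1,\dots,k\}$ be any function. If the level set $M_g=\{x\in G: g(x)=K_k\}$ is not empty, then it is a $(q-k)$-manifold.
   Context: A finite abstract simplicial complex $G$ is a finite set of non-empty finite sets closed under taking non-empty subsets; $V(G)=\bigcup_{x\in G}x$, and the empty complex is called the void. For $x\in G$, $U(x)=\{y\in G:x\subset y\}$, the closure $\overline{U(x)}$ is the set of all non-empty subsets of elements of $U(x)$, and $S(x)=\overline{U(x)}\setminus U(x)$. Contractible complexes are defined recursively: the one-point complex is contractible, and $G$ is contractible if there is $x\in G$ such that both $S(x)$ and $G\setminus U(x)$ are contractible; the void is not contractible. The void is the $(-1)$-sphere. For $q\ge 0$, a $q$-manifold is a finite abstract simplicial complex such that every $S(x)$, $x\in G$, is a $(q-1)$-sphere, and a $q$-sphere is a $q$-manifold $G$ for which there is $x\in G$ such that $G\setminus U(x)$ is contractible. For $x=\{x_0,\dots,x_n\}\in G$, $g(x)=\{g(x_0),\dots,g(x_n)\}$. The set $M_g$ is in general not a simplicial complex; "$M_g$ is a manifold" means that the following simplicial complex is: the Whitney complex (non-empty vertex sets of complete subgraphs) of the graph whose vertices are the elements of $M_g$ and in which two distinct $a,b\in M_g$ are adjacent iff $a\subset b$ or $b\subset a$. *)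

theory Defs
  imports Main "HOL-Library.FuncSet"
begin

definition simplicial_complex :: "'a set set \<Rightarrow> bool" where
  "simplicial_complex G \<longleftrightarrow>
     finite G \<and> (\<forall>x\<in>G. finite x \<and> x \<noteq> {}) \<and>
     (\<forall>x\<in>G. \<forall>y. y \<subseteq> x \<and> y \<noteq> {} \<longrightarrow> y \<in> G)"

definition vertices :: "'a set set \<Rightarrow> 'a set" where
  "vertices G = \<Union>G"

text \<open>The inclusion is not strict: the star of \<open>x\<close> contains \<open>x\<close> itself.\<close>

definition star :: "'a set set \<Rightarrow> 'a set \<Rightarrow> 'a set set" where
  "star G x = {y \<in> G. x \<subseteq> y}"

definition simplicial_closure :: "'a set set \<Rightarrow> 'a set set" where
  "simplicial_closure A = {z. z \<noteq> {} \<and> (\<exists>y\<in>A. z \<subseteq> y)}"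

definition unit_sphere :: "'a set set \<Rightarrow> 'a set \<Rightarrow> 'a set set" where
  "unit_sphere G x = simplicial_closure (star G x) - star G x"

inductive contractible_complex :: "'a set set \<Rightarrow> bool" where
  one_point: "contractible_complex {{v}}"
| extend: "\<lbrakk>simplicial_complex G; x \<in> G; contractible_complex (unit_sphere G x);
    contractible_complex (G - star G x)\<rbrakk> \<Longrightarrow> contractible_complex G"

text \<open>Dimensions are integers, so that the \<open>(-1)\<close>-sphere exists and differences of dimensions
  do not truncate.  There are no manifolds of negative dimension, and the only sphere of negative
  dimension is the void.  The void is vacuously a \<open>q\<close>-manifold for every \<open>q \<ge> 0\<close>.\<close>

inductive manifold :: "int \<Rightarrow> 'a set set \<Rightarrow> bool"
  and sphere_complex :: "int \<Rightarrow> 'a set set \<Rightarrow> bool" where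
  void_sphere: "sphere_complex (-1) {}"
| manifold: "\<lbrakk>q \<ge> 0; simplicial_complex G; \<forall>x\<in>G. sphere_complex (q - 1) (unit_sphere G x)\<rbrakk>
    \<Longrightarrow> manifold q G"
| sphere: "\<lbrakk>q \<ge> 0; manifold q G; \<exists>x\<in>G. contractible_complex (G - star G x)\<rbrakk>
    \<Longrightarrow> sphere_complex q G"

definition whitney_complex :: "'v set \<Rightarrow> ('v \<Rightarrow> 'v \<Rightarrow> bool) \<Rightarrow> 'v set set" where
  "whitney_complex V adj =
     {c. c \<noteq> {} \<and> finite c \<and> c \<subseteq> V \<and> (\<forall>a\<in>c. \<forall>b\<in>c. a \<noteq> b \<longrightarrow> adj a b)}"

definition level_set :: "'a set set \<Rightarrow> ('a \<Rightarrow> nat) \<Rightarrow> nat \<Rightarrow> 'a set set" where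
  "level_set G g k = {x \<in> G. g ` x = {0..k}}"

definition inclusion_complex :: "'a set set \<Rightarrow> 'a set set set" where
  "inclusion_complex M = whitney_complex M (\<lambda>a b. a \<subset> b \<or> b \<subset> a)"

end

theory Submission
  imports Defs
begin

text \<open>A complex is a \<open>q\<close>-manifold as soon as its vertex links are \<open>(q - 1)\<close>-spheres, because
  \<open>S(x)\<close> is the join of the boundary of \<open>x\<close> with the link of \<open>x\<close>, links of simplices in spheres are
  spheres, and so are joins of spheres.  A vertex of the inclusion complex of \<open>M\<^sub>g\<close> is a simplex
  \<open>p \<in> M\<^sub>g\<close>, and its link is the join of two order complexes: that of \<open>{y \<subset> p. g(y) = K\<^sub>k}\<close>, the
  boundary of a product of simplices and thus a sphere of dimension \<open>|p| - k - 2\<close>, and that of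
  \<open>{y \<in> G. p \<subset> y}\<close>, the barycentric subdivision of the link of \<open>p\<close> in \<open>G\<close>, a sphere of dimension
  \<open>q - |p|\<close>.  The latter needs that barycentric subdivision preserves contractibility; it is a
  sequence of stellar subdivisions, each of which preserves contractibility.\<close>

section \<open>Complexes with the empty simplex\<close>

text \<open>Contractibility and spheres are defined by removing stars, not up to homeomorphism, so a
  subdivided sphere has to be shown to be a sphere by exhibiting a star whose removal leaves a
  contractible complex. For the barycentric subdivision of a sphere \<open>Q\<close>, what is at
  hand is a simplex \<open>z\<close> whose star can be removed from \<open>Q\<close>; the vertex
  \<open>z\<close> of the subdivision is removed instead, and the rest is compared with the
  barycentric subdivision of what remains of \<open>Q\<close>. The simplices removed in a
  contraction may have any size, so a contraction of a complex does not translate step by step into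
  one of its order complex. Stellar subdivision reduces the comparison to the removed simplex and a
  single subdivided one. All complexes contain the empty simplex: the void becomes
  \<open>{{}}\<close>, the neutral element of the join, and unit spheres, links and joins obey
  formulas without exceptional cases.\<close>

definition acomplex :: "'a set set \<Rightarrow> bool" where
  "acomplex K \<longleftrightarrow> finite K \<and> {} \<in> K \<and> (\<forall>x\<in>K. finite x \<and> (\<forall>y. y \<subseteq> x \<longrightarrow> y \<in> K))"

text \<open>For a non-empty simplex \<open>x\<close> of a complex \<open>K\<close> this is
  \<open>S(x)\<close> together with the empty simplex: \<open>z\<close> lies in the closure of the
  star of \<open>x\<close> exactly when \<open>z \<union> x\<close> is a simplex.\<close>

definition usphere :: "'a set set \<Rightarrow> 'a set \<Rightarrow> 'a set set" where
  "usphere K x = {z. \<not> x \<subseteq> z \<and> z \<union> x \<in> K}"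

definition deletion :: "'a set set \<Rightarrow> 'a set \<Rightarrow> 'a set set" where
  "deletion K x = {z \<in> K. \<not> x \<subseteq> z}"

definition link :: "'a set set \<Rightarrow> 'a set \<Rightarrow> 'a set set" where
  "link K x = {z. z \<inter> x = {} \<and> z \<union> x \<in> K}"

definition join :: "'a set set \<Rightarrow> 'a set set \<Rightarrow> 'a set set" where
  "join J K = {a \<union> b | a b. a \<in> J \<and> b \<in> K}"

definition boundary :: "'a set \<Rightarrow> 'a set set" where
  "boundary x = {y. y \<subset> x}"

lemma mem_usphere: "z \<in> usphere K x \<longleftrightarrow> \<not> x \<subseteq> z \<and> z \<union> x \<in> K"
  by (simp add: usphere_def)

lemma mem_deletion: "z \<in> deletion K x \<longleftrightarrow> z \<in> K \<and> \<not> x \<subseteq> z"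
  by (simp add: deletion_def)

lemma acomplex_down: "acomplex K \<Longrightarrow> x \<in> K \<Longrightarrow> y \<subseteq> x \<Longrightarrow> y \<in> K"
  by (auto simp: acomplex_def)

lemma acomplex_finite: "acomplex K \<Longrightarrow> finite K"
  by (auto simp: acomplex_def)

lemma acomplex_finite_simplex: "acomplex K \<Longrightarrow> x \<in> K \<Longrightarrow> finite x"
  by (auto simp: acomplex_def)

lemma acomplex_empty: "acomplex K \<Longrightarrow> {} \<in> K"
  by (auto simp: acomplex_def)

lemma acomplexI:
  assumes "finite K" "{} \<in> K" "\<And>x. x \<in> K \<Longrightarrow> finite x" "\<And>x y. x \<in> K \<Longrightarrow> y \<subseteq> x \<Longrightarrow> y \<in> K"
  shows "acomplex K"
  using assms by (auto simp: acomplex_def)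

lemma usphere_subset: "acomplex K \<Longrightarrow> usphere K x \<subseteq> K - {x}"
  by (auto simp: usphere_def intro: acomplex_down)

lemma deletion_subset: "deletion K x \<subseteq> K - {x}"
  by (auto simp: deletion_def)

lemma link_subset: "acomplex K \<Longrightarrow> link K x \<subseteq> K"
  by (auto simp: link_def intro: acomplex_down)

lemma acomplex_subset:
  assumes "acomplex K" "L \<subseteq> K" "{} \<in> L" "\<And>x y. x \<in> L \<Longrightarrow> y \<subseteq> x \<Longrightarrow> y \<in> L"
  shows "acomplex L"
  using assms by (intro acomplexI) (auto intro: finite_subset acomplex_finite acomplex_finite_simplex)

lemma acomplex_usphere:
  assumes "acomplex K" "x \<in> K" "x \<noteq> {}"
  shows "acomplex (usphere K x)"
proof (rule acomplex_subset[OF assms(1)])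
  show "usphere K x \<subseteq> K" using usphere_subset[OF assms(1)] by blast
  show "{} \<in> usphere K x" using assms by (auto simp: usphere_def)
  show "y \<in> usphere K x" if "z \<in> usphere K x" "y \<subseteq> z" for y z
    using that acomplex_down[OF assms(1), of "z \<union> x" "y \<union> x"] by (auto simp: usphere_def)
qed

lemma acomplex_deletion:
  assumes "acomplex K" "x \<noteq> {}"
  shows "acomplex (deletion K x)"
  using assms by (intro acomplex_subset[OF assms(1)]) (auto simp: deletion_def acomplex_def)

lemma acomplex_join:
  assumes "acomplex J" "acomplex K"
  shows "acomplex (join J K)"
proof (rule acomplexI)
  have "join J K = (\<lambda>(a, b). a \<union> b) ` (J \<times> K)" by (auto simp: join_def)
  then show "finite (join J K)" using assms by (simp add: acomplex_finite)
  show "{} \<in> join J K" using assms by (auto simp: join_def acomplex_empty)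
  show "finite x" if "x \<in> join J K" for x
    using that assms by (auto simp: join_def acomplex_finite_simplex)
  show "y \<in> join J K" if x: "x \<in> join J K" "y \<subseteq> x" for x y
  proof -
    obtain a b where ab: "x = a \<union> b" "a \<in> J" "b \<in> K" using x(1) by (auto simp: join_def)
    have "y = (y \<inter> a) \<union> (y \<inter> b)" using ab x by auto
    moreover have "y \<inter> a \<in> J" "y \<inter> b \<in> K"
      using ab assms by (meson acomplex_down inf_le2)+
    ultimately show ?thesis by (auto simp: join_def)
  qed
qed

lemma acomplex_Pow: "finite x \<Longrightarrow> acomplex (Pow x)"
  by (auto intro!: acomplexI intro: finite_subset)

lemma acomplex_boundary: "finite x \<Longrightarrow> x \<noteq> {} \<Longrightarrow> acomplex (boundary x)"
  by (rule acomplex_subset[OF acomplex_Pow]) (auto simp: boundary_def)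

lemma join_void_left [simp]: "join {{}} K = K"
  by (auto simp: join_def)

lemma join_void_right [simp]: "join J {{}} = J"
  by (auto simp: join_def)

section \<open>Deletions, unit spheres and links in joins and simplex boundaries\<close>

lemma deletion_join:
  assumes "x \<in> J" "\<Union>J \<inter> \<Union>K = {}"
  shows "deletion (join J K) x = join (deletion J x) K"
proof -
  have "x \<subseteq> a" if "x \<subseteq> a \<union> b" "a \<in> J" "b \<in> K" for a b
    using assms that by blast
  then show ?thesis unfolding deletion_def join_def by blast
qed

lemma usphere_join:
  assumes "acomplex J" "acomplex K" "x \<in> J" "\<Union>J \<inter> \<Union>K = {}"
  shows "usphere (join J K) x = join (usphere J x) K"
proof (intro subset_antisym subsetI)
  fix z assume "z \<in> usphere (join J K) x"
  then have z: "\<not> x \<subseteq> z" "z \<union> x \<in> join J K" by (auto simp: usphere_def)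
  then obtain a b where ab: "z \<union> x = a \<union> b" "a \<in> J" "b \<in> K" by (auto simp: join_def)
  have xa: "x \<subseteq> a" using ab assms(3,4) by blast
  have "b \<subseteq> z" using ab assms(3,4) by blast
  have "(z \<inter> a) \<union> x = a" using ab xa assms by blast
  then have "z \<inter> a \<in> usphere J x" using z ab by (auto simp: usphere_def)
  moreover have "z = (z \<inter> a) \<union> b" using ab \<open>b \<subseteq> z\<close> by blast
  ultimately show "z \<in> join (usphere J x) K" using ab(3) unfolding join_def by blast
next
  fix z assume "z \<in> join (usphere J x) K"
  then obtain a b where ab: "z = a \<union> b" "\<not> x \<subseteq> a" "a \<union> x \<in> J" "b \<in> K"
    by (auto simp: join_def usphere_def)
  have "\<not> x \<subseteq> z" using ab assms(3,4) by blast
  moreover have "z \<union> x = (a \<union> x) \<union> b" using ab by blast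
  ultimately show "z \<in> usphere (join J K) x" using ab unfolding usphere_def join_def by blast
qed

lemma usphere_eq_join:
  assumes "acomplex K" "x \<in> K"
  shows "usphere K x = join (boundary x) (link K x)"
proof (intro subset_antisym subsetI)
  fix z assume z: "z \<in> usphere K x"
  then have "z \<inter> x \<in> boundary x" "z - x \<in> link K x"
    by (auto simp: usphere_def boundary_def link_def)
  moreover have "z = (z \<inter> x) \<union> (z - x)" by blast
  ultimately show "z \<in> join (boundary x) (link K x)" unfolding join_def by blast
next
  fix z assume "z \<in> join (boundary x) (link K x)"
  then obtain a b where ab: "z = a \<union> b" "a \<subset> x" "b \<inter> x = {}" "b \<union> x \<in> K"
    by (auto simp: join_def boundary_def link_def)
  then have "z \<union> x = b \<union> x" by blast
  then show "z \<in> usphere K x" using ab by (auto simp: usphere_def)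
qed

lemma link_join:
  assumes "acomplex J" "acomplex K" "a \<in> J" "b \<in> K" "\<Union>J \<inter> \<Union>K = {}"
  shows "link (join J K) (a \<union> b) = join (link J a) (link K b)"
proof (intro subset_antisym subsetI)
  fix z assume "z \<in> link (join J K) (a \<union> b)"
  then obtain c d where z: "z \<inter> (a \<union> b) = {}" "z \<union> (a \<union> b) = c \<union> d" "c \<in> J" "d \<in> K"
    by (auto simp: link_def join_def)
  have "a \<subseteq> c" "b \<subseteq> d" using z assms(3-5) by blast+
  then have "c - a \<union> a = c" "d - b \<union> b = d" by blast+
  then have "c - a \<in> link J a" "d - b \<in> link K b" using z by (auto simp: link_def)
  moreover have "z = (c - a) \<union> (d - b)" using z assms(3-5) by blast
  ultimately show "z \<in> join (link J a) (link K b)" unfolding join_def by blast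
next
  fix z assume "z \<in> join (link J a) (link K b)"
  then obtain c d where z: "z = c \<union> d" "c \<inter> a = {}" "d \<inter> b = {}" "c \<union> a \<in> J" "d \<union> b \<in> K"
    by (auto simp: link_def join_def)
  have "z \<union> (a \<union> b) = (c \<union> a) \<union> (d \<union> b)" using z by blast
  moreover have "z \<inter> (a \<union> b) = {}" using z assms(3-5) by blast
  ultimately show "z \<in> link (join J K) (a \<union> b)" using z(4,5) unfolding link_def join_def by blast
qed

text \<open>The second factor is the link of \<open>y\<close> in the boundary of \<open>x\<close>.
  Unit spheres in a simplex boundary are thus joins of two smaller simplex boundaries, which ties
  boundaries to joins in the induction for spheres.\<close>

lemma usphere_boundary:
  assumes "y \<subset> x" "y \<noteq> {}"
  shows "usphere (boundary x) y = join (boundary y) (boundary (x - y))"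
proof (intro subset_antisym subsetI)
  fix z assume "z \<in> usphere (boundary x) y"
  then have "z \<inter> y \<in> boundary y" "z - y \<in> boundary (x - y)"
    by (auto simp: usphere_def boundary_def)
  moreover have "z = (z \<inter> y) \<union> (z - y)" by blast
  ultimately show "z \<in> join (boundary y) (boundary (x - y))" unfolding join_def by blast
next
  fix z assume "z \<in> join (boundary y) (boundary (x - y))"
  then show "z \<in> usphere (boundary x) y"
    using assms by (auto simp: join_def boundary_def usphere_def)
qed

text \<open>The unit sphere of a vertex is its link, so links can be computed by peeling off one
  vertex at a time.\<close>

lemma link_insert: "v \<notin> a \<Longrightarrow> link K (insert v a) = link (usphere K {v}) a"
  by (auto simp: link_def usphere_def)

lemma link_empty [simp]: "link K {} = K"
  by (auto simp: link_def)

lemma Union_usphere: "acomplex K \<Longrightarrow> \<Union>(usphere K x) \<subseteq> \<Union>K"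
  using usphere_subset by blast

lemma Union_deletion: "\<Union>(deletion K x) \<subseteq> \<Union>K"
  using deletion_subset by blast

lemma Union_link: "acomplex K \<Longrightarrow> \<Union>(link K x) \<subseteq> \<Union>K"
  using link_subset by blast

section \<open>Contractibility\<close>

inductive acontractible :: "'a set set \<Rightarrow> bool" where
  single_vertex: "acontractible (Pow {v})"
| remove_star: "\<lbrakk>acomplex K; x \<in> K; x \<noteq> {}; acontractible (usphere K x); acontractible (deletion K x)\<rbrakk> \<Longrightarrow> acontractible K"

lemma acontractible_acomplex: "acontractible K \<Longrightarrow> acomplex K"
  by (induction rule: acontractible.induct) (auto simp: acomplex_Pow)

text \<open>If a non-empty simplex \<open>x\<close> avoids the apex \<open>v\<close>, then both its
  unit sphere and its deletion are again cones with apex \<open>v\<close>. Removing such stars ends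
  when only the apex is left.\<close>

lemma acontractible_cone:
  assumes "acomplex L" "{v} \<in> L" "\<And>z. z \<in> L \<Longrightarrow> insert v z \<in> L"
  shows "acontractible L"
  using assms
proof (induction "card L" arbitrary: L rule: less_induct)
  case less
  show ?case
  proof (cases "L \<subseteq> Pow {v}")
    case True
    moreover have "Pow {v} = {{}, {v}}" by blast
    ultimately have "L = Pow {v}" using less.prems(2) acomplex_empty[OF less.prems(1)] by auto
    then show ?thesis by (simp add: single_vertex)
  next
    case False
    then obtain y where y: "y \<in> L" "\<not> y \<subseteq> {v}" by blast
    define x where "x = y - {v}"
    have x: "x \<in> L" "x \<noteq> {}" "v \<notin> x"
      using y acomplex_down[OF less.prems(1) y(1)] by (auto simp: x_def)
    have fin: "finite L" using less.prems acomplex_finite by blast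
    have small: "card M < card L" if "M \<subseteq> L - {x}" for M
    proof -
      have "M \<subset> L" using that x(1) by blast
      then show ?thesis using fin by (rule psubset_card_mono[rotated])
    qed
    have "acontractible (usphere L x)"
    proof (rule less.hyps)
      show "card (usphere L x) < card L" by (rule small[OF usphere_subset[OF less.prems(1)]])
      show "acomplex (usphere L x)" using x less.prems acomplex_usphere by blast
      show "{v} \<in> usphere L x" using x less.prems(3)[of x] by (auto simp: usphere_def)
      show "insert v z \<in> usphere L x" if "z \<in> usphere L x" for z
        using that x less.prems(3)[of "z \<union> x"] by (auto simp: usphere_def)
    qed
    moreover have "acontractible (deletion L x)"
    proof (rule less.hyps)
      show "card (deletion L x) < card L" by (rule small[OF deletion_subset])
      show "acomplex (deletion L x)" using x less.prems acomplex_deletion by blast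
      show "{v} \<in> deletion L x" using x less.prems(2) by (auto simp: deletion_def)
      show "insert v z \<in> deletion L x" if "z \<in> deletion L x" for z
        using that x less.prems(3)[of z] by (auto simp: deletion_def)
    qed
    ultimately show ?thesis using x less.prems(1) remove_star by blast
  qed
qed

lemma acontractible_Pow: "finite x \<Longrightarrow> x \<noteq> {} \<Longrightarrow> acontractible (Pow x)"
  by (rule acontractible_cone[of _ "SOME v. v \<in> x"]) (auto simp: acomplex_Pow some_in_eq)

text \<open>Removing the star of a simplex of \<open>C\<close> affects only the first factor of the
  join, so a contraction of \<open>C\<close> lifts to the join until \<open>C\<close> is a point and
  the join a cone.\<close>

lemma acontractible_join:
  assumes "acontractible C" "acomplex K" "\<Union>C \<inter> \<Union>K = {}"
  shows "acontractible (join C K)"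
  using assms
proof (induction rule: acontractible.induct)
  case (single_vertex v)
  show ?case
  proof (rule acontractible_cone[of _ v])
    show "acomplex (join (Pow {v}) K)" using single_vertex by (simp add: acomplex_join acomplex_Pow)
    show "{v} \<in> join (Pow {v}) K" using single_vertex acomplex_empty by (auto simp: join_def)
    show "insert v z \<in> join (Pow {v}) K" if z: "z \<in> join (Pow {v}) K" for z
    proof -
      obtain a b where "a \<in> Pow {v}" "b \<in> K" "z = a \<union> b" using z unfolding join_def by blast
      then have "insert v z = {v} \<union> b" by blast
      then show ?thesis using \<open>b \<in> K\<close> unfolding join_def by blast
    qed
  qed
next
  case (remove_star C x)
  have "acomplex (join C K)" using remove_star acomplex_join by blast
  moreover have "x \<union> {} \<in> join C K"
    using remove_star(2) acomplex_empty[OF remove_star.prems(1)] unfolding join_def by blast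
  then have "x \<in> join C K" by simp
  moreover have "acontractible (usphere (join C K) x)"
  proof -
    have "\<Union>(usphere C x) \<inter> \<Union>K = {}"
      using remove_star.prems(2) Union_usphere[OF remove_star(1), of x] by blast
    then have "acontractible (join (usphere C x) K)" by (rule remove_star.IH(1)[OF remove_star.prems(1)])
    then show ?thesis using usphere_join[OF remove_star(1) remove_star.prems(1) remove_star(2)]
      remove_star.prems(2) by simp
  qed
  moreover have "acontractible (deletion (join C K) x)"
  proof -
    have "\<Union>(deletion C x) \<inter> \<Union>K = {}"
      using remove_star.prems(2) Union_deletion[of C x] by blast
    then have "acontractible (join (deletion C x) K)" by (rule remove_star.IH(2)[OF remove_star.prems(1)])
    then show ?thesis using deletion_join[OF remove_star(2) remove_star.prems(2)] by simp
  qed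
  ultimately show ?case using remove_star(3) acontractible.remove_star by blast
qed

text \<open>Serves the passage from a vertex \<open>v\<close> to the vertex \<open>{v}\<close> of a
  subdivision, and the translation of a face poset by a fixed simplex.\<close>

lemma acontractible_relabel:
  assumes "acontractible K" "inj_on f (\<Union>K)"
  shows "acontractible ((`) f ` K)"
  using assms
proof (induction rule: acontractible.induct)
  case (single_vertex v)
  have "(`) f ` Pow {v} = Pow {f v}" by (auto simp: Pow_insert)
  then show ?case by (simp add: acontractible.single_vertex)
next
  case (remove_star K x)
  let ?F = "(`) f"
  have inj: "f ` a \<subseteq> f ` b \<longleftrightarrow> a \<subseteq> b" if "a \<subseteq> \<Union>K" "b \<subseteq> \<Union>K" for a b
  proof
    assume f: "f ` a \<subseteq> f ` b"
    show "a \<subseteq> b"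
    proof
      fix u assume "u \<in> a"
      then have "f u \<in> f ` b" "u \<in> \<Union>K" using f that by blast+
      then show "u \<in> b"
        using inj_on_image_mem_iff[OF remove_star.prems] that(2) by blast
    qed
  qed auto
  have K: "a \<subseteq> \<Union>K" if "a \<in> K" for a using that by blast
  have cx: "acomplex (?F ` K)"
  proof (rule acomplexI)
    show "y \<in> ?F ` K" if "z \<in> ?F ` K" "y \<subseteq> z" for y z
      using that remove_star(1) by (auto simp: subset_image_iff intro!: imageI intro: acomplex_down)
  qed (use remove_star(1) in \<open>auto simp: acomplex_def\<close>)
  have "deletion (?F ` K) (f ` x) = ?F ` deletion K x"
  proof -
    have "f ` x \<subseteq> f ` z \<longleftrightarrow> x \<subseteq> z" if "z \<in> K" for z using inj[OF K K] remove_star(2) that by simp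
    then show ?thesis unfolding deletion_def by blast
  qed
  moreover have "usphere (?F ` K) (f ` x) = ?F ` usphere K x"
  proof (intro subset_antisym subsetI)
    fix z assume "z \<in> usphere (?F ` K) (f ` x)"
    then obtain y where z: "\<not> f ` x \<subseteq> z" "z \<union> f ` x = f ` y" "y \<in> K" by (auto simp: usphere_def)
    have "z \<subseteq> f ` y" using z(2) by blast
    then obtain y' where y': "z = f ` y'" "y' \<subseteq> y" by (auto simp: subset_image_iff)
    have "f ` (y' \<union> x) = f ` y" using z y' by (simp add: image_Un)
    moreover have "y' \<union> x \<subseteq> \<Union>K" "y \<subseteq> \<Union>K" using z(3) y'(2) remove_star(2) by blast+
    ultimately have "y' \<union> x = y" using inj_on_image_eq_iff[OF remove_star.prems] by blast
    then have "y' \<in> usphere K x" using z y' by (auto simp: usphere_def)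
    then show "z \<in> ?F ` usphere K x" using y' by blast
  next
    fix z assume "z \<in> ?F ` usphere K x"
    then obtain y where y: "z = f ` y" "\<not> x \<subseteq> y" "y \<union> x \<in> K" by (auto simp: usphere_def)
    have "\<not> f ` x \<subseteq> f ` y" using inj[of x y] y by auto
    then show "z \<in> usphere (?F ` K) (f ` x)" using y unfolding usphere_def by (auto simp flip: image_Un)
  qed
  moreover have "acontractible (?F ` usphere K x)" "acontractible (?F ` deletion K x)"
    using remove_star.IH remove_star.prems Union_usphere[OF remove_star(1), of x] Union_deletion[of K x]
    by (meson inj_on_subset)+
  ultimately show ?case using cx acontractible.remove_star[of "?F ` K" "f ` x"] remove_star(2,3) by auto
qed

section \<open>Spheres\<close>

text \<open>The index is the dimension plus one, so that indices add up under joins.\<close>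

primrec asphere :: "nat \<Rightarrow> 'a set set \<Rightarrow> bool" where
  "asphere 0 K \<longleftrightarrow> K = {{}}"
| "asphere (Suc n) K \<longleftrightarrow> acomplex K \<and> (\<forall>x\<in>K - {{}}. asphere n (usphere K x)) \<and>
     (\<exists>x\<in>K - {{}}. acontractible (deletion K x))"

lemma asphere_acomplex: "asphere n K \<Longrightarrow> acomplex K"
  by (cases n) (auto simp: acomplex_def)

text \<open>With a vertex \<open>v\<close> of \<open>a\<close> peeled off, the link of
  \<open>a\<close> becomes the link of \<open>a - {v}\<close> in the sphere
  \<open>usphere K {v}\<close>, whose index is one lower than that expected of \<open>K\<close>. The
  hypothesis is the manifold condition only, which says nothing about the link of \<open>{}\<close>,
  namely \<open>K\<close> itself.\<close>

lemma asphere_link_of_usphere: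
  assumes "acomplex K" "\<forall>x\<in>K - {{}}. asphere n (usphere K x)" "a \<in> K"
  shows "card a \<le> Suc n \<and> (a \<noteq> {} \<longrightarrow> asphere (Suc n - card a) (link K a))"
  using assms
proof (induction n arbitrary: K a)
  case 0
  show ?case
  proof (cases "a = {}")
    case False
    then obtain v where v: "v \<in> a" by blast
    then have "{v} \<in> K" using 0 acomplex_down by blast
    then have S: "usphere K {v} = {{}}" using 0 by auto
    have "a - {v} \<in> usphere K {v}" using v 0 by (auto simp: usphere_def insert_absorb)
    then have "a - {v} = {}" using S by simp
    then have "a = {v}" using v by blast
    then show ?thesis using S link_insert[of v "{}" K] by simp
  qed simp
next
  case (Suc n)
  show ?case
  proof (cases "a = {}")
    case False
    then obtain v b where v: "a = insert v b" "v \<notin> b" by (metis Set.set_insert ex_in_conv)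
    then have vK: "{v} \<in> K" using Suc.prems acomplex_down by blast
    then have S: "asphere (Suc n) (usphere K {v})" using Suc.prems by blast
    have b: "b \<in> usphere K {v}" using v Suc.prems by (auto simp: usphere_def)
    have "finite a" using Suc.prems acomplex_finite_simplex by blast
    then have "finite b" using v(1) by simp
    then have card: "card a = Suc (card b)" using v by simp
    have "card b \<le> Suc n \<and> (b \<noteq> {} \<longrightarrow> asphere (Suc n - card b) (link (usphere K {v}) b))"
      by (rule Suc.IH) (use S b in auto)
    then show ?thesis using card link_insert[OF v(2), of K] v(1) S by (cases "b = {}") auto
  qed simp
qed

lemma asphere_link:
  assumes "asphere n K" "a \<in> K"
  shows "card a \<le> n" "asphere (n - card a) (link K a)"
proof -
  have "card a \<le> n \<and> asphere (n - card a) (link K a)"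
  proof (cases n)
    case 0
    then show ?thesis using assms by auto
  next
    case (Suc m)
    then show ?thesis using assms asphere_link_of_usphere[of K m a] by (cases "a = {}") auto
  qed
  then show "card a \<le> n" "asphere (n - card a) (link K a)" by auto
qed

text \<open>The two claims need each other: a unit sphere in a boundary is a join of boundaries, and
  a unit sphere in a join is the join of the boundary of \<open>x\<close> with a join of links.
  Everything these reductions call for has smaller index, so one induction proves both.\<close>

lemma asphere_boundary_and_join:
  "(\<forall>x :: 'a set. finite x \<longrightarrow> card x = Suc n \<longrightarrow> asphere n (boundary x)) \<and>
   (\<forall>l m. \<forall>J K :: 'a set set. l + m = n \<longrightarrow> asphere l J \<longrightarrow> asphere m K \<longrightarrow> \<Union>J \<inter> \<Union>K = {} \<longrightarrow>
     asphere n (join J K))"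
proof (induction n rule: less_induct)
  case (less n)
  have bd: "asphere (card x - 1) (boundary x)" if "finite x" "x \<noteq> {}" "card x \<le> n" for x :: "'a set"
  proof -
    have "0 < card x" using that by (simp add: card_gt_0_iff)
    then have "card x - 1 < n" "card x = Suc (card x - 1)" using that(3) by linarith+
    then show ?thesis using less that(1) by metis
  qed
  have jn: "asphere (l + m) (join J K)"
    if "l + m < n" "asphere l J" "asphere m K" "\<Union>J \<inter> \<Union>K = {}" for l m and J K :: "'a set set"
    using that less by blast
  show ?case
  proof (intro conjI allI impI)
    fix x :: "'a set" assume x: "finite x" "card x = Suc n"
    show "asphere n (boundary x)"
    proof (cases n)
      case 0
      then obtain v where "x = {v}" using x card_1_singletonE by auto
      then show ?thesis using 0 by (auto simp: boundary_def)
    next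
      case (Suc k)
      have "asphere k (usphere (boundary x) y)" if "y \<in> boundary x - {{}}" for y
      proof -
        have y: "y \<subset> x" "y \<noteq> {}" "finite y" using that x finite_subset by (auto simp: boundary_def)
        have cards: "0 < card y" "card y < card x" "card (x - y) = card x - card y"
          using x y psubset_card_mono[OF x(1) y(1)]
          by (simp_all add: card_gt_0_iff card_Diff_subset psubset_imp_subset)
        have "asphere (card y - 1 + (card (x - y) - 1)) (join (boundary y) (boundary (x - y)))"
        proof (rule jn)
          show "asphere (card y - 1) (boundary y)" using y cards x by (intro bd) auto
          show "asphere (card (x - y) - 1) (boundary (x - y))" using y cards x by (intro bd) auto
        qed (use cards x in \<open>auto simp: boundary_def\<close>)
        then show ?thesis using cards x Suc usphere_boundary[OF y(1,2)] by simp
      qed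
      moreover obtain v where v: "v \<in> x" using x by fastforce
      \<comment> \<open>Removing the star of a vertex from the boundary leaves the opposite face
        with all its subsets, which is a cone.\<close>
      have "deletion (boundary x) {v} = Pow (x - {v})"
        using v by (auto simp: deletion_def boundary_def)
      moreover have "x - {v} \<noteq> {}" using x v Suc by (metis card.empty card_Diff_singleton diff_Suc_1 nat.distinct(1))
      then have "acontractible (Pow (x - {v}))" "{v} \<in> boundary x - {{}}"
        using x v by (auto simp: boundary_def intro!: acontractible_Pow)
      moreover have "acomplex (boundary x)" using x v by (intro acomplex_boundary) auto
      ultimately show ?thesis unfolding Suc asphere.simps by metis
    qed
  next
    fix l m and J K :: "'a set set"
    assume lm: "l + m = n" "asphere l J" "asphere m K" "\<Union>J \<inter> \<Union>K = {}"
    show "asphere n (join J K)"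
    proof (cases l)
      case 0
      then show ?thesis using lm by simp
    next
      case (Suc l')
      note cx = asphere_acomplex[OF lm(2)] asphere_acomplex[OF lm(3)]
      obtain k where k: "n = Suc k" using lm Suc by auto
      have "asphere k (usphere (join J K) x)" if x: "x \<in> join J K - {{}}" for x
      proof -
        obtain a b where ab: "x = a \<union> b" "a \<in> J" "b \<in> K" using x by (auto simp: join_def)
        have fin: "finite a" "finite b" using ab cx acomplex_finite_simplex by blast+
        have "a \<inter> b = {}" using ab lm(4) by blast
        then have card: "card x = card a + card b" using ab fin by (simp add: card_Un_disjoint)
        have pos: "0 < card x" using x ab fin by (simp add: card_gt_0_iff)
        have la: "card a \<le> l" "asphere (l - card a) (link J a)" using asphere_link[OF lm(2) ab(2)] .
        have lb: "card b \<le> m" "asphere (m - card b) (link K b)" using asphere_link[OF lm(3) ab(3)] .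
        have lk: "asphere (l - card a + (m - card b)) (join (link J a) (link K b))"
        proof (rule jn[OF _ la(2) lb(2)])
          show "l - card a + (m - card b) < n" using la(1) lb(1) pos card lm(1) by linarith
          show "\<Union>(link J a) \<inter> \<Union>(link K b) = {}"
            using lm(4) Union_link[OF cx(1), of a] Union_link[OF cx(2), of b] by blast
        qed
        have "asphere (card x - 1 + (l - card a + (m - card b)))
          (join (boundary x) (link (join J K) x))"
        proof (rule jn)
          show "card x - 1 + (l - card a + (m - card b)) < n" using pos card la lb lm by linarith
          show "asphere (card x - 1) (boundary x)"
            using pos card la(1) lb(1) lm(1) ab fin by (intro bd) auto
          show "asphere (l - card a + (m - card b)) (link (join J K) x)"
            using lk link_join[OF cx ab(2,3) lm(4)] ab(1) by simp
          show "\<Union> (boundary x) \<inter> \<Union> (link (join J K) x) = {}" by (auto simp: boundary_def link_def)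
        qed
        moreover have "card x - 1 + (l - card a + (m - card b)) = k"
          using pos card la(1) lb(1) lm(1) k by linarith
        ultimately show ?thesis using usphere_eq_join[OF acomplex_join[OF cx]] x by simp
      qed
      \<comment> \<open>The simplex that opens \<open>J\<close> also opens the join, because
        deletion acts on the first factor.\<close>
      moreover obtain x where x: "x \<in> J" "x \<noteq> {}" "acontractible (deletion J x)" using lm(2) Suc by auto
      have "\<Union>(deletion J x) \<inter> \<Union>K = {}" using lm(4) Union_deletion[of J x] by blast
      then have "acontractible (deletion (join J K) x)"
        using deletion_join[OF x(1) lm(4)] acontractible_join[OF x(3) cx(2)] by simp
      moreover have "x \<union> {} \<in> join J K" using x(1) acomplex_empty[OF cx(2)] unfolding join_def by blast
      ultimately show ?thesis using k x(2) acomplex_join[OF cx] by auto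
    qed
  qed
qed

lemma asphere_boundary:
  assumes "finite x" "x \<noteq> {}"
  shows "asphere (card x - 1) (boundary x)"
proof -
  have "card x = Suc (card x - 1)" using assms by (simp add: card_gt_0_iff)
  then show ?thesis using asphere_boundary_and_join assms(1) by blast
qed

lemma asphere_join:
  assumes "asphere l J" "asphere m K" "\<Union>J \<inter> \<Union>K = {}"
  shows "asphere (l + m) (join J K)"
  using assms asphere_boundary_and_join by blast

lemma asphere_usphere_of_vertices:
  assumes K: "acomplex K" and v: "\<And>v. {v} \<in> K \<Longrightarrow> asphere n (usphere K {v})"
    and x: "x \<in> K" "x \<noteq> {}"
  shows "asphere n (usphere K x)"
proof -
  obtain v b where b: "x = insert v b" "v \<notin> b" using x by (meson mk_disjoint_insert ex_in_conv)
  then have vK: "{v} \<in> K" using K x acomplex_down by blast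
  have bS: "b \<in> usphere K {v}" using b x by (auto simp: usphere_def)
  have fin: "finite x" using x K acomplex_finite_simplex by blast
  then have card: "card x = Suc (card b)" using b by simp
  have l: "card b \<le> n" "asphere (n - card b) (link K x)"
    using asphere_link[OF v[OF vK] bS] link_insert[OF b(2), of K] b(1) by auto
  have "asphere (card x - 1 + (n - card b)) (join (boundary x) (link K x))"
    using asphere_boundary[OF fin x(2)] l(2)
    by (rule asphere_join) (auto simp: boundary_def link_def)
  then show ?thesis using card l(1) usphere_eq_join[OF K x(1)] by simp
qed

section \<open>Stellar subdivision\<close>

text \<open>Meant for \<open>w\<close> outside the vertex set of \<open>K\<close>.\<close>

definition stellar :: "'a set set \<Rightarrow> 'a set \<Rightarrow> 'a \<Rightarrow> 'a set set" where
  "stellar K Y w = deletion K Y \<union> insert w ` {t. t \<union> Y \<in> K \<and> \<not> Y \<subseteq> t}"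

lemma mem_stellar_iff:
  assumes "w \<notin> \<Union>K"
  shows "z \<in> stellar K Y w \<longleftrightarrow>
    (if w \<in> z then (z - {w}) \<union> Y \<in> K \<and> \<not> Y \<subseteq> z else z \<in> K \<and> \<not> Y \<subseteq> z)"
proof (cases "w \<in> z")
  case True
  have "z \<in> stellar K Y w \<longleftrightarrow> (\<exists>t. z = insert w t \<and> t \<union> Y \<in> K \<and> \<not> Y \<subseteq> t)"
    using True assms by (auto simp: stellar_def deletion_def)
  also have "\<dots> \<longleftrightarrow> (z - {w}) \<union> Y \<in> K \<and> \<not> Y \<subseteq> z"
  proof
    assume "\<exists>t. z = insert w t \<and> t \<union> Y \<in> K \<and> \<not> Y \<subseteq> t"
    then obtain t where t: "z = insert w t" "t \<union> Y \<in> K" "\<not> Y \<subseteq> t" by blast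
    then have "w \<notin> t" "w \<notin> Y" using assms by blast+
    then show "(z - {w}) \<union> Y \<in> K \<and> \<not> Y \<subseteq> z" using t by auto
  next
    assume a: "(z - {w}) \<union> Y \<in> K \<and> \<not> Y \<subseteq> z"
    moreover have "z = insert w (z - {w})" using True by blast
    ultimately show "\<exists>t. z = insert w t \<and> t \<union> Y \<in> K \<and> \<not> Y \<subseteq> t" by blast
  qed
  finally show ?thesis using True by simp
next
  case False
  then show ?thesis by (auto simp: stellar_def deletion_def)
qed

lemma acomplex_stellar:
  assumes "acomplex K" "Y \<noteq> {}" "w \<notin> \<Union>K"
  shows "acomplex (stellar K Y w)"
proof (rule acomplexI)
  have "{t. t \<union> Y \<in> K \<and> \<not> Y \<subseteq> t} \<subseteq> K" using assms(1) by (auto intro: acomplex_down)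
  then show "finite (stellar K Y w)"
    unfolding stellar_def using finite_subset[OF _ acomplex_finite[OF assms(1)]] deletion_subset[of K Y]
    by blast
  show "{} \<in> stellar K Y w" using assms acomplex_empty by (auto simp: mem_stellar_iff)
  show "finite x" if "x \<in> stellar K Y w" for x
    using that assms acomplex_finite_simplex by (fastforce simp: stellar_def deletion_def)
  show "y \<in> stellar K Y w" if x: "x \<in> stellar K Y w" and y: "y \<subseteq> x" for x y
  proof (cases "w \<in> x")
    case True
    then have x': "(x - {w}) \<union> Y \<in> K" "\<not> Y \<subseteq> x" using x by (auto simp: mem_stellar_iff[OF assms(3)])
    have "y - {w} \<union> Y \<in> K"
      by (rule acomplex_down[OF assms(1) x'(1)]) (use y in blast)
    moreover have "y - {w} \<in> K"
      by (rule acomplex_down[OF assms(1) x'(1)]) (use y in blast)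
    ultimately show ?thesis using x' y by (auto simp: mem_stellar_iff[OF assms(3)])
  next
    case False
    then show ?thesis using x y acomplex_down[OF assms(1)]
      by (auto simp: mem_stellar_iff[OF assms(3)])
  qed
qed

lemma stellar_trivial: "acomplex K \<Longrightarrow> Y \<notin> K \<Longrightarrow> stellar K Y w = K"
  by (auto simp: stellar_def deletion_def intro: acomplex_down)

section \<open>Unit spheres and deletions in a stellar subdivision\<close>

text \<open>\<open>z \<union> x\<close> contains \<open>Y\<close> exactly when \<open>z\<close>
  contains \<open>Y - x\<close>, so the unit sphere of \<open>x\<close> sees the subdivision of
  \<open>Y\<close> as a subdivision of \<open>Y - x\<close>.\<close>

lemma usphere_stellar:
  assumes "w \<notin> \<Union>K" "x \<in> K" "\<not> Y \<subseteq> x" "acomplex K"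
  shows "usphere (stellar K Y w) x = stellar (usphere K x) (Y - x) w"
proof (rule set_eqI)
  fix z
  have wS: "w \<notin> \<Union>(usphere K x)" using assms(1) Union_usphere[OF assms(4), of x] by blast
  have wx: "w \<notin> x" using assms(1,2) by blast
  show "z \<in> usphere (stellar K Y w) x \<longleftrightarrow> z \<in> stellar (usphere K x) (Y - x) w"
  proof (cases "w \<in> z")
    case True
    have "(z \<union> x) - {w} \<union> Y = (z - {w}) \<union> (Y - x) \<union> x" using wx by blast
    moreover have "\<not> x \<subseteq> z - {w} \<union> (Y - x) \<longleftrightarrow> \<not> x \<subseteq> z" using wx by blast
    moreover have "\<not> Y \<subseteq> z \<union> x \<longleftrightarrow> \<not> Y - x \<subseteq> z" by blast
    ultimately show ?thesis using True wx
      by (simp add: mem_usphere mem_stellar_iff[OF assms(1)] mem_stellar_iff[OF wS] del: Un_Diff_cancel2)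
  next
    case False
    then show ?thesis using wx by (auto simp: mem_usphere mem_stellar_iff[OF assms(1)] mem_stellar_iff[OF wS])
  qed
qed

text \<open>The two sides can differ only in simplices that contain \<open>w\<close> and
  \<open>x - Y\<close> but not \<open>x\<close>: these survive the deletion of \<open>x\<close>
  after subdividing, but do not arise when \<open>x\<close> is deleted first. The last hypothesis
  rules them out.\<close>

lemma deletion_stellar:
  assumes "w \<notin> \<Union>K" "x \<in> K" "acomplex K" "x \<union> Y \<notin> K \<or> x \<inter> Y = {}"
  shows "deletion (stellar K Y w) x = stellar (deletion K x) Y w"
proof (rule set_eqI)
  fix z
  have wS: "w \<notin> \<Union>(deletion K x)" using assms(1) Union_deletion[of K x] by blast
  have wx: "w \<notin> x" using assms(1,2) by blast
  have "\<not> x \<subseteq> (z - {w}) \<union> Y" if "z - {w} \<union> Y \<in> K" "\<not> x \<subseteq> z"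
  proof
    assume x: "x \<subseteq> (z - {w}) \<union> Y"
    then have "x \<union> Y \<in> K" using acomplex_down[OF assms(3) that(1)] by blast
    then show False using x that assms(4) by blast
  qed
  then show "z \<in> deletion (stellar K Y w) x \<longleftrightarrow> z \<in> stellar (deletion K x) Y w"
    using wx by (auto simp: mem_deletion mem_stellar_iff[OF assms(1)] mem_stellar_iff[OF wS])
qed

text \<open>In general the surplus simplices are those containing \<open>insert w (x - Y)\<close>,
  and a second deletion disposes of them.\<close>

lemma deletion_deletion_stellar:
  assumes "w \<notin> \<Union>K" "x \<in> K" "acomplex K"
  shows "deletion (deletion (stellar K Y w) x) (insert w (x - Y)) = stellar (deletion K x) Y w"
proof (rule set_eqI)
  fix z
  have wS: "w \<notin> \<Union>(deletion K x)" using assms(1) Union_deletion[of K x] by blast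
  have wx: "w \<notin> x" using assms(1,2) by blast
  show "z \<in> deletion (deletion (stellar K Y w) x) (insert w (x - Y)) \<longleftrightarrow> z \<in> stellar (deletion K x) Y w"
    using wx by (auto simp: mem_deletion mem_stellar_iff[OF assms(1)] mem_stellar_iff[OF wS])
qed

text \<open>If \<open>K\<close> contracts by removing the star of \<open>x\<close>, then the subdivision contracts by removing the
  star of \<open>w\<close> (\<open>Y = x\<close>), of \<open>w\<close> joined with \<open>x - Y\<close> (\<open>Y \<subset> x\<close>), or of \<open>x\<close>, after which the
  remaining simplices containing \<open>w\<close> and \<open>x - Y\<close> still have to be removed; their unit sphere is a
  cone whose apex is any vertex of \<open>Y - x\<close>.\<close>

lemma acontractible_stellar:
  assumes "acontractible K" "Y \<noteq> {}" "w \<notin> \<Union>K"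
  shows "acontractible (stellar K Y w)"
  using assms
proof (induction arbitrary: Y rule: acontractible.induct)
  case (single_vertex v)
  show ?case
  proof (cases "Y = {v}")
    case True
    have "stellar (Pow {v}) Y w = Pow {w}"
      unfolding set_eq_iff mem_stellar_iff[OF single_vertex(2)] using True single_vertex by auto
    then show ?thesis by (simp add: acontractible.single_vertex)
  next
    case False
    then have "Y \<notin> Pow {v}" using single_vertex by auto
    then show ?thesis using stellar_trivial[of "Pow {v}" Y w]
      by (simp add: acomplex_Pow acontractible.single_vertex)
  qed
next
  case (remove_star K x)
  note cx = remove_star(1)
  have w: "w \<notin> \<Union>K" by fact
  note mem = mem_stellar_iff[OF w]
  have wx: "w \<notin> x" using w remove_star(2) by blast
  have cst: "acomplex (stellar K Y w)" by (rule acomplex_stellar[OF cx remove_star.prems])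
  have IHs: "acontractible (stellar (usphere K x) Z w)" if "Z \<noteq> {}" for Z
  proof -
    have "w \<notin> \<Union>(usphere K x)" using Union_usphere[OF cx, of x] w by blast
    then show ?thesis by (rule remove_star.IH(1)[OF that])
  qed
  have IHd: "acontractible (stellar (deletion K x) Y w)"
  proof -
    have "w \<notin> \<Union>(deletion K x)" using Union_deletion[of K x] w by blast
    then show ?thesis by (rule remove_star.IH(2)[OF remove_star.prems(1)])
  qed
  consider "Y = x" | "Y \<subset> x" | "\<not> Y \<subseteq> x" by blast
  then show ?case
  proof cases
    case 1
    have "usphere (stellar K Y w) {w} = usphere K x"
    proof (rule set_eqI)
      fix z
      have "z - {w} \<union> x \<in> K \<Longrightarrow> w \<in> z \<Longrightarrow> False" if "z \<union> x \<in> K" using w that by blast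
      then show "z \<in> usphere (stellar K Y w) {w} \<longleftrightarrow> z \<in> usphere K x"
        using 1 wx w by (cases "w \<in> z") (auto simp: mem_usphere mem)
    qed
    moreover have "deletion (stellar K Y w) {w} = deletion K x"
      unfolding set_eq_iff mem_deletion mem using 1 w by auto
    moreover have "{w} \<in> stellar K Y w" using 1 wx remove_star(2,3) by (auto simp: mem)
    ultimately show ?thesis using acontractible.remove_star[OF cst, of "{w}"] remove_star(4,5) by simp
  next
    case 2
    let ?X = "insert w (x - Y)"
    have "?X \<in> stellar K Y w" using 2 wx remove_star by (auto simp: mem Un_absorb2)
    moreover have "deletion (stellar K Y w) ?X = stellar (deletion K x) Y w"
    proof -
      \<comment> \<open>As \<open>Y \<subset> x\<close>, no simplex of the subdivision contains
        \<open>x\<close>.\<close>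
      have "deletion (stellar K Y w) x = stellar K Y w"
      proof -
        have "Y \<subseteq> z" if "x \<subseteq> z" for z using 2 that by blast
        then show ?thesis unfolding set_eq_iff mem_deletion mem by metis
      qed
      then show ?thesis using deletion_deletion_stellar[OF w remove_star(2) cx, of Y] by simp
    qed
    \<comment> \<open>Here \<open>Y - x\<close> is empty; it is \<open>Y\<close> itself, a proper
      face of \<open>x\<close> and hence a simplex of \<open>usphere K x\<close>, that gets
      subdivided in the unit sphere.\<close>
    moreover have "usphere (stellar K Y w) ?X = stellar (usphere K x) Y w"
    proof (rule set_eqI)
      fix z
      have wS: "w \<notin> \<Union>(usphere K x)" using w Union_usphere[OF cx, of x] by blast
      have e: "z \<union> ?X - {w} \<union> Y = (z - {w}) \<union> x" using 2 wx by blast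
      have e': "z - {w} \<union> Y \<union> x = (z - {w}) \<union> x" using 2 by blast
      show "z \<in> usphere (stellar K Y w) ?X \<longleftrightarrow> z \<in> stellar (usphere K x) Y w"
      proof (cases "w \<in> z")
        case True
        have "\<not> Y \<subseteq> z \<union> ?X \<longleftrightarrow> \<not> Y \<subseteq> z" using True by blast
        moreover have "x - Y \<subseteq> z \<longleftrightarrow> x \<subseteq> (z - {w}) \<union> Y" using True wx 2 by blast
        ultimately show ?thesis using True
          by (simp add: mem_usphere mem mem_stellar_iff[OF wS] e e' del: Un_insert_right Un_Diff_cancel2)
      next
        case False
        have "\<not> Y \<subseteq> z \<union> ?X \<longleftrightarrow> \<not> Y \<subseteq> z" using 2 wx by blast
        moreover have "\<not> x \<subseteq> z" if "\<not> Y \<subseteq> z" using that 2 by blast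
        ultimately show ?thesis using False e
          by (auto simp: mem_usphere mem mem_stellar_iff[OF wS] simp del: Un_insert_right Un_Diff_cancel2)
      qed
    qed
    ultimately show ?thesis using acontractible.remove_star[OF cst, of ?X] IHs[OF remove_star.prems(1)] IHd by simp
  next
    case 3
    let ?H = "deletion (stellar K Y w) x"
    have xst: "x \<in> stellar K Y w" using 3 wx remove_star(2) by (simp add: mem)
    have cH: "acomplex ?H" using cst acomplex_deletion remove_star(3) by blast
    have "acontractible ?H"
    proof (cases "x \<union> Y \<notin> K \<or> x \<inter> Y = {}")
      case True
      then show ?thesis using deletion_stellar[OF w remove_star(2) cx] IHd by simp
    next
      case False
      then have xY: "x \<union> Y \<in> K" "x \<inter> Y \<noteq> {}" by auto
      let ?X = "insert w (x - Y)"
      obtain v where v: "v \<in> Y" "v \<notin> x" using 3 by blast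
      have vw: "v \<noteq> w" using v xY w by blast
      have e: "z \<union> ?X - {w} \<union> Y = (z - {w}) \<union> x \<union> Y" for z using wx by blast
      have US: "z \<in> usphere ?H ?X \<longleftrightarrow> \<not> ?X \<subseteq> z \<and> (z - {w}) \<union> x \<union> Y \<in> K \<and> \<not> x \<inter> Y \<subseteq> z" for z
      proof -
        have "\<not> x \<subseteq> z \<union> ?X \<longleftrightarrow> \<not> x \<inter> Y \<subseteq> z" using wx by blast
        moreover have "\<not> Y \<subseteq> z \<union> ?X" if "\<not> x \<inter> Y \<subseteq> z" using that wx by blast
        moreover have "z \<union> ?X \<in> stellar K Y w \<longleftrightarrow> (z - {w}) \<union> x \<union> Y \<in> K \<and> \<not> Y \<subseteq> z \<union> ?X"
          unfolding mem e by simp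
        ultimately show ?thesis unfolding mem_usphere mem_deletion by metis
      qed
      have "acontractible (usphere ?H ?X)"
      \<comment> \<open>The description \<open>US\<close> is insensitive to adding \<open>v\<close>:
        the union with \<open>Y\<close> absorbs it, and it lies neither in
        \<open>x \<inter> Y\<close> nor in \<open>?X\<close>.\<close>
      proof (rule acontractible_cone[of _ v])
        have "{} \<in> usphere ?H ?X" using xY by (simp add: US)
        then have "?X \<in> ?H" by (simp add: mem_usphere)
        then show "acomplex (usphere ?H ?X)" using cH by (intro acomplex_usphere) auto
        show "{v} \<in> usphere ?H ?X" using xY v vw by (auto simp: US insert_absorb)
        show "insert v z \<in> usphere ?H ?X" if "z \<in> usphere ?H ?X" for z
        proof -
          have "insert v z - {w} \<union> x \<union> Y = (z - {w}) \<union> x \<union> Y" using v vw by blast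
          then show ?thesis using that v vw unfolding US by auto
        qed
      qed
      moreover have "?X \<in> ?H" using xY wx by (auto simp: mem_deletion mem Un_commute)
      ultimately show ?thesis
        using acontractible.remove_star[OF cH, of ?X] deletion_deletion_stellar[OF w remove_star(2) cx, of Y] IHd
        by simp
    qed
    moreover have "acontractible (usphere (stellar K Y w) x)"
      using usphere_stellar[OF w remove_star(2) 3 cx] IHs[of "Y - x"] 3 by auto
    ultimately show ?thesis using acontractible.remove_star[OF cst xst remove_star(3)] by simp
  qed
qed

section \<open>Order complexes\<close>

definition order_complex :: "'a set set \<Rightarrow> 'a set set set" where
  "order_complex P = {c. c \<subseteq> P \<and> (\<forall>a\<in>c. \<forall>b\<in>c. a \<subseteq> b \<or> b \<subseteq> a)}"

lemma acomplex_order_complex: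
  assumes "finite P"
  shows "acomplex (order_complex P)"
proof (rule acomplexI)
  have "order_complex P \<subseteq> Pow P" by (auto simp: order_complex_def)
  then show "finite (order_complex P)" using assms finite_subset by auto
  show "finite c" if "c \<in> order_complex P" for c
    using that assms finite_subset by (auto simp: order_complex_def)
  show "d \<in> order_complex P" if "c \<in> order_complex P" "d \<subseteq> c" for c d
    using that unfolding order_complex_def by blast
qed (simp add: order_complex_def)

lemma Union_order_complex: "\<Union>(order_complex P) \<subseteq> P"
  unfolding order_complex_def by blast

lemma order_complex_empty [simp]: "order_complex {} = {{}}"
  by (auto simp: order_complex_def)

lemma deletion_order_complex: "deletion (order_complex P) {p} = order_complex (P - {p})"
  by (auto simp: deletion_def order_complex_def)

lemma usphere_order_complex:
  assumes "p \<in> P"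
  shows "usphere (order_complex P) {p} =
    join (order_complex {y \<in> P. y \<subset> p}) (order_complex {y \<in> P. p \<subset> y})"
proof (intro subset_antisym subsetI)
  fix c assume "c \<in> usphere (order_complex P) {p}"
  then have c: "p \<notin> c" "c \<subseteq> P" "\<forall>a\<in>c. a \<subseteq> p \<or> p \<subseteq> a" "\<forall>a\<in>c. \<forall>b\<in>c. a \<subseteq> b \<or> b \<subseteq> a"
    by (auto simp: usphere_def order_complex_def)
  have "c = {y \<in> c. y \<subset> p} \<union> {y \<in> c. p \<subset> y}" using c by blast
  moreover have "{y \<in> c. y \<subset> p} \<in> order_complex {y \<in> P. y \<subset> p}"
    "{y \<in> c. p \<subset> y} \<in> order_complex {y \<in> P. p \<subset> y}"
    using c by (auto simp: order_complex_def)
  ultimately show "c \<in> join (order_complex {y \<in> P. y \<subset> p}) (order_complex {y \<in> P. p \<subset> y})"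
    unfolding join_def by blast
next
  fix c assume "c \<in> join (order_complex {y \<in> P. y \<subset> p}) (order_complex {y \<in> P. p \<subset> y})"
  then obtain d e where "c = d \<union> e" "d \<in> order_complex {y \<in> P. y \<subset> p}"
    "e \<in> order_complex {y \<in> P. p \<subset> y}"
    unfolding join_def by blast
  then have de: "c = d \<union> e" "\<forall>y\<in>d. y \<in> P \<and> y \<subset> p" "\<forall>y\<in>e. y \<in> P \<and> p \<subset> y"
    "\<forall>a\<in>d. \<forall>b\<in>d. a \<subseteq> b \<or> b \<subseteq> a" "\<forall>a\<in>e. \<forall>b\<in>e. a \<subseteq> b \<or> b \<subseteq> a"
    by (auto simp: order_complex_def)
  have "p \<notin> c" "c \<subseteq> P" using de by blast+
  moreover have "a \<subseteq> b \<or> b \<subseteq> a" if ab: "a \<in> insert p c" "b \<in> insert p c" for a b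
  proof -
    have lo: "t \<subseteq> p" if "t \<in> d" for t using de(2) that by blast
    have hi: "p \<subseteq> t" if "t \<in> e" for t using de(3) that by blast
    consider "a \<in> d" "b \<in> d" | "a \<in> e" "b \<in> e" | "a \<in> insert p d" "b \<in> insert p e"
      | "b \<in> insert p d" "a \<in> insert p e"
      using ab de(1) by auto
    then show ?thesis
    proof cases
      case 3
      then have "a \<subseteq> p" "p \<subseteq> b" using lo hi by auto
      then show ?thesis by (meson order_trans)
    next
      case 4
      then have "b \<subseteq> p" "p \<subseteq> a" using lo hi by auto
      then show ?thesis by (meson order_trans)
    qed (use de(4,5) in auto)
  qed
  ultimately show "c \<in> usphere (order_complex P) {p}"
    using assms by (auto simp: usphere_def order_complex_def)
qed

lemma disjoint_below_above:
  "\<Union>(order_complex {y \<in> P. y \<subset> p}) \<inter> \<Union>(order_complex {y \<in> P. p \<subset> y}) = {}"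
  using Union_order_complex[of "{y \<in> P. y \<subset> p}"] Union_order_complex[of "{y \<in> P. p \<subset> y}"]
  by blast

section \<open>Removing elements of a poset and retracting it\<close>

lemma join_commute: "join J K = join K J"
  unfolding join_def by (metis Un_commute)

text \<open>The unit sphere of the vertex \<open>p\<close> is the join of the chains below and above
  \<open>p\<close>, and one contractible factor makes the join contractible.\<close>

lemma acontractible_order_complex_remove:
  assumes "finite P" "p \<in> P" "acontractible (order_complex (P - {p}))"
    and "acontractible (order_complex {y \<in> P. y \<subset> p}) \<or> acontractible (order_complex {y \<in> P. p \<subset> y})"
  shows "acontractible (order_complex P)"
proof -
  have fin: "finite {y \<in> P. y \<subset> p}" "finite {y \<in> P. p \<subset> y}" using assms(1) by simp_all
  have "acontractible (usphere (order_complex P) {p})"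
    unfolding usphere_order_complex[OF assms(2)] using assms(4)
  proof
    assume "acontractible (order_complex {y \<in> P. y \<subset> p})"
    then show "acontractible (join (order_complex {y \<in> P. y \<subset> p}) (order_complex {y \<in> P. p \<subset> y}))"
      using acomplex_order_complex[OF fin(2)] disjoint_below_above by (rule acontractible_join)
  next
    assume "acontractible (order_complex {y \<in> P. p \<subset> y})"
    then show "acontractible (join (order_complex {y \<in> P. y \<subset> p}) (order_complex {y \<in> P. p \<subset> y}))"
      unfolding join_commute[of "order_complex {y \<in> P. y \<subset> p}"]
      using acomplex_order_complex[OF fin(1)] disjoint_below_above[of P p]
      by (intro acontractible_join) (simp_all add: Int_commute)
  qed
  moreover have "{p} \<in> order_complex P" using assms(2) by (auto simp: order_complex_def)
  ultimately show ?thesis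
    using remove_star[OF acomplex_order_complex[OF assms(1)], of "{p}"] assms(3)
    by (simp add: deletion_order_complex)
qed

lemma acontractible_order_complex_cone:
  assumes "finite P" "m \<in> P" "\<And>z. z \<in> P \<Longrightarrow> z \<subseteq> m \<or> m \<subseteq> z"
  shows "acontractible (order_complex P)"
proof (rule acontractible_cone[OF acomplex_order_complex[OF assms(1)]])
  show "{m} \<in> order_complex P" using assms(2) by (auto simp: order_complex_def)
  show "insert m c \<in> order_complex P" if "c \<in> order_complex P" for c
    using that assms(2,3) unfolding order_complex_def by blast
qed

text \<open>The moved points are removed one by one. If \<open>f\<close> is increasing, let
  \<open>p\<close> be a maximal moved point: every \<open>z\<close> above it is fixed, so
  \<open>f p \<subseteq> f z = z\<close>, and \<open>f p\<close> is the least element above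
  \<open>p\<close>. The elements above \<open>p\<close> therefore form a cone. The decreasing case
  is dual, with a minimal moved point.\<close>

lemma acontractible_order_complex_retract:
  assumes "finite P" "f ` P \<subseteq> P"
    and "\<And>x y. x \<in> P \<Longrightarrow> y \<in> P \<Longrightarrow> x \<subseteq> y \<Longrightarrow> f x \<subseteq> f y"
    and "\<And>x. x \<in> P \<Longrightarrow> f (f x) = f x"
    and "(\<forall>x\<in>P. x \<subseteq> f x) \<or> (\<forall>x\<in>P. f x \<subseteq> x)"
    and "acontractible (order_complex (f ` P))"
  shows "acontractible (order_complex P)"
  using assms
proof (induction "card P" arbitrary: P rule: less_induct)
  case less
  define N where "N = {x \<in> P. f x \<noteq> x}"
  have finN: "finite N" using less.prems(1) by (simp add: N_def)
  show ?case
  proof (cases "N = {}")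
    case True
    then have "f ` P = P" unfolding N_def by force
    then show ?thesis using less.prems(6) by simp
  next
    case False
    have "\<exists>p\<in>N. acontractible (order_complex {y \<in> P. y \<subset> p}) \<or> acontractible (order_complex {y \<in> P. p \<subset> y})"
      using less.prems(5)
    proof
      assume up: "\<forall>x\<in>P. x \<subseteq> f x"
      obtain p where p: "p \<in> N" "\<And>x. x \<in> N \<Longrightarrow> p \<subseteq> x \<Longrightarrow> p = x"
        using finite_has_maximal[OF finN False] by blast
      have pP: "p \<in> P" "p \<subset> f p" using p(1) up by (auto simp: N_def)
      have "acontractible (order_complex {y \<in> P. p \<subset> y})"
      proof (rule acontractible_order_complex_cone[of _ "f p"])
        show "f p \<in> {y \<in> P. p \<subset> y}" using pP less.prems(2) by blast
        fix z assume z: "z \<in> {y \<in> P. p \<subset> y}"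
        then have "f z = z" using p(2)[of z] by (auto simp: N_def)
        then show "z \<subseteq> f p \<or> f p \<subseteq> z" using less.prems(3)[of p z] z pP by auto
      qed (use less.prems(1) in simp)
      then show ?thesis using p(1) by blast
    next
      assume down: "\<forall>x\<in>P. f x \<subseteq> x"
      obtain p where p: "p \<in> N" "\<And>x. x \<in> N \<Longrightarrow> x \<subseteq> p \<Longrightarrow> p = x"
        using finite_has_minimal[OF finN False] by blast
      have pP: "p \<in> P" "f p \<subset> p" using p(1) down by (auto simp: N_def)
      have "acontractible (order_complex {y \<in> P. y \<subset> p})"
      proof (rule acontractible_order_complex_cone[of _ "f p"])
        show "f p \<in> {y \<in> P. y \<subset> p}" using pP less.prems(2) by blast
        fix z assume z: "z \<in> {y \<in> P. y \<subset> p}"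
        then have "f z = z" using p(2)[of z] by (auto simp: N_def)
        then show "z \<subseteq> f p \<or> f p \<subseteq> z" using less.prems(3)[of z p] z pP by auto
      qed (use less.prems(1) in simp)
      then show ?thesis using p(1) by blast
    qed
    then obtain p where p: "p \<in> P" "f p \<noteq> p"
      "acontractible (order_complex {y \<in> P. y \<subset> p}) \<or> acontractible (order_complex {y \<in> P. p \<subset> y})"
      by (auto simp: N_def)
    \<comment> \<open>By idempotence every value of \<open>f\<close> is a fixed point. The moved
      point \<open>p\<close> is therefore no value, and dropping it leaves a self-map with the same
      image.\<close>
    have neq: "f x \<noteq> p" if "x \<in> P" for x using less.prems(4)[OF that] p(2) by auto
    have "f p \<in> f ` (P - {p})" using less.prems(2,4) p(1,2) by (metis Diff_iff image_subset_iff imageI singletonD)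
    then have img: "f ` (P - {p}) = f ` P" using p(1) by blast
    have "acontractible (order_complex (P - {p}))"
    proof (rule less.hyps)
      show "card (P - {p}) < card P" using less.prems(1) p(1) by (rule card_Diff1_less)
      show "f ` (P - {p}) \<subseteq> P - {p}" using less.prems(2) neq by blast
      show "(\<forall>x\<in>P - {p}. x \<subseteq> f x) \<or> (\<forall>x\<in>P - {p}. f x \<subseteq> x)" using less.prems(5) by blast
      show "acontractible (order_complex (f ` (P - {p})))" using img less.prems(6) by simp
    qed (use less.prems(1,3,4) in auto)
    then show ?thesis using acontractible_order_complex_remove less.prems(1) p(1,3) by blast
  qed
qed

section \<open>Barycentric subdivision of contractible complexes\<close>

text \<open>Performing stellar subdivisions in order of decreasing size, one reaches after subdividing the
  up-closed set \<open>A\<close> of simplices the complex below.  Its vertices are the original ones, written as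
  singletons, and the elements of \<open>A\<close>.\<close>

definition partial_subdivision :: "'a set set \<Rightarrow> 'a set set \<Rightarrow> 'a set set set" where
  "partial_subdivision C A = {c. c \<subseteq> A \<union> (\<lambda>v. {v}) ` \<Union>C \<and>
     (\<forall>a\<in>c \<inter> A. \<forall>t\<in>c. a \<subseteq> t \<or> t \<subseteq> a) \<and> \<Union>(c - A) \<in> C - A}"

lemma partial_subdivisionD:
  assumes "c \<in> partial_subdivision C A"
  shows "c \<subseteq> A \<union> (\<lambda>v. {v}) ` \<Union>C" "\<forall>a\<in>c \<inter> A. \<forall>t\<in>c. a \<subseteq> t \<or> t \<subseteq> a" "\<Union>(c - A) \<in> C - A"
proof -
  note * = assms[unfolded partial_subdivision_def mem_Collect_eq]
  show "c \<subseteq> A \<union> (\<lambda>v. {v}) ` \<Union>C" by (rule conjunct1[OF *])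
  show "\<forall>a\<in>c \<inter> A. \<forall>t\<in>c. a \<subseteq> t \<or> t \<subseteq> a" by (rule conjunct1[OF conjunct2[OF *]])
  show "\<Union>(c - A) \<in> C - A" by (rule conjunct2[OF conjunct2[OF *]])
qed

lemma partial_subdivisionI:
  assumes "c \<subseteq> A \<union> (\<lambda>v. {v}) ` \<Union>C" "\<And>a t. a \<in> c \<inter> A \<Longrightarrow> t \<in> c \<Longrightarrow> a \<subseteq> t \<or> t \<subseteq> a" "\<Union>(c - A) \<in> C - A"
  shows "c \<in> partial_subdivision C A"
  unfolding partial_subdivision_def mem_Collect_eq
  using assms(1,3) by (intro conjI ballI assms(2))

lemma partial_subdivision_empty: "partial_subdivision C {} = (`) (\<lambda>v. {v}) ` C"
proof -
  have "c \<in> (`) (\<lambda>v. {v}) ` C" if c: "c \<subseteq> (\<lambda>v. {v}) ` \<Union>C" "\<Union>c \<in> C" for c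
  proof -
    have sing: "\<exists>v. t = {v}" if "t \<in> c" for t using c that by blast
    have "c = (\<lambda>v. {v}) ` \<Union>c"
    proof (intro equalityI subsetI)
      fix t assume "t \<in> c"
      with sing show "t \<in> (\<lambda>v. {v}) ` \<Union>c" by fastforce
    next
      fix t assume "t \<in> (\<lambda>v. {v}) ` \<Union>c"
      then obtain v a where "t = {v}" "v \<in> a" "a \<in> c" by blast
      with sing[of a] show "t \<in> c" by auto
    qed
    then show ?thesis using c(2) by blast
  qed
  then show ?thesis by (auto simp: partial_subdivision_def)
qed

text \<open>Once all simplices with at least two vertices are subdivided, the old vertices in a
  simplex \<open>c\<close> span a simplex with at most one vertex, so \<open>c\<close> is just a
  chain.\<close>

lemma partial_subdivision_all:
  assumes "acomplex C"
  shows "partial_subdivision C {a \<in> C. 2 \<le> card a} = order_complex (C - {{}})"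
proof (rule set_eqI)
  fix c
  let ?A = "{a \<in> C. 2 \<le> card a}"
  have sing: "a \<in> ?A \<or> (\<exists>v. a = {v})" if "a \<in> C - {{}}" for a
  proof -
    have "finite a" using that acomplex_finite_simplex[OF assms] by blast
    then have "card a \<noteq> 0" using that by simp
    then have "card a = 1 \<or> 2 \<le> card a" by linarith
    then show ?thesis using that by (auto simp: card_1_singleton_iff)
  qed
  have vC: "{v} \<in> C" if "v \<in> \<Union>C" for v using that acomplex_down[OF assms] by blast
  show "c \<in> partial_subdivision C ?A \<longleftrightarrow> c \<in> order_complex (C - {{}})"
  proof
    assume "c \<in> partial_subdivision C ?A"
    then have c: "c \<subseteq> ?A \<union> (\<lambda>v. {v}) ` \<Union>C" "\<forall>a\<in>c \<inter> ?A. \<forall>t\<in>c. a \<subseteq> t \<or> t \<subseteq> a"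
      "\<Union>(c - ?A) \<in> C - ?A"
      unfolding partial_subdivision_def by blast+
    have "c \<subseteq> C - {{}}" using c(1) vC by auto
    moreover have "a \<subseteq> b \<or> b \<subseteq> a" if ab: "a \<in> c" "b \<in> c" for a b
    proof (cases "a \<in> ?A \<or> b \<in> ?A")
      case True
      then show ?thesis using c(2) ab by blast
    next
      case False
      then have "a \<in> (\<lambda>v. {v}) ` \<Union>C" "b \<in> (\<lambda>v. {v}) ` \<Union>C" using ab c(1) by auto
      then obtain u v where uv: "a = {u}" "b = {v}" by auto
      then have "{u, v} \<subseteq> \<Union>(c - ?A)" using False ab by blast
      then have "{u, v} \<in> C" using c(3) acomplex_down[OF assms] by blast
      moreover have "finite (\<Union>(c - ?A))" using c(3) acomplex_finite_simplex[OF assms] by blast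
      then have "card {u, v} \<le> card (\<Union>(c - ?A))" using \<open>{u, v} \<subseteq> \<Union>(c - ?A)\<close> by (rule card_mono)
      moreover have "card (\<Union>(c - ?A)) < 2" using c(3) by auto
      ultimately have "u = v" by (cases "u = v") auto
      then show ?thesis using uv by simp
    qed
    ultimately show "c \<in> order_complex (C - {{}})" unfolding order_complex_def by blast
  next
    assume "c \<in> order_complex (C - {{}})"
    then have c: "c \<subseteq> C - {{}}" "\<forall>a\<in>c. \<forall>b\<in>c. a \<subseteq> b \<or> b \<subseteq> a"
      unfolding order_complex_def by blast+
    have "\<Union>(c - ?A) \<in> C - ?A"
    proof (cases "c - ?A = {}")
      case True
      then show ?thesis unfolding True using acomplex_empty[OF assms] by simp
    next
      case False
      then obtain a where a: "a \<in> c - ?A" by blast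
      then obtain v where v: "a = {v}" using sing c(1) by blast
      have "b = {v}" if b: "b \<in> c - ?A" for b
      proof -
        obtain u where "b = {u}" using b sing c(1) by blast
        moreover have "a \<subseteq> b \<or> b \<subseteq> a" using c(2) a b by blast
        ultimately show ?thesis using v by blast
      qed
      then have "c - ?A = {{v}}" using a v by blast
      then have "\<Union>(c - ?A) = {v}" by simp
      moreover have "{v} \<in> C - ?A" using a v c(1) by auto
      ultimately show ?thesis by simp
    qed
    moreover have "c \<subseteq> ?A \<union> (\<lambda>v. {v}) ` \<Union>C" using c(1) sing by blast
    moreover have "\<forall>a\<in>c \<inter> ?A. \<forall>t\<in>c. a \<subseteq> t \<or> t \<subseteq> a" using c(2) by blast
    ultimately show "c \<in> partial_subdivision C ?A" unfolding partial_subdivision_def by blast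
  qed
qed

text \<open>Everything strictly above the minimal element \<open>y\<close> is subdivided already,
  while \<open>y\<close> is still the simplex spanned by its singletons; the step puts a barycenter
  into it. In a simplex containing that barycenter, the old vertices span a proper face of
  \<open>y\<close>, and every other element of \<open>A\<close> contains \<open>y\<close>.\<close>

lemma partial_subdivision_step:
  assumes C: "acomplex C" and A: "A \<subseteq> {a \<in> C. 2 \<le> card a}"
    and up: "\<And>a b. a \<in> A \<Longrightarrow> b \<in> C \<Longrightarrow> a \<subseteq> b \<Longrightarrow> b \<in> A"
    and y: "y \<in> A" and min: "\<And>a. a \<in> A \<Longrightarrow> a \<subseteq> y \<Longrightarrow> a = y"
  shows "y \<notin> \<Union>(partial_subdivision C (A - {y}))"
    and "partial_subdivision C A = stellar (partial_subdivision C (A - {y})) ((\<lambda>v. {v}) ` y) y"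
proof -
  let ?s = "\<lambda>v. {v}" and ?B = "A - {y}"
  have yC: "y \<in> C" using y A by blast
  have nosing: "{v} \<notin> A" for v using A by auto
  show w: "y \<notin> \<Union>(partial_subdivision C ?B)"
  proof
    assume "y \<in> \<Union>(partial_subdivision C ?B)"
    then obtain c where "c \<in> partial_subdivision C ?B" "y \<in> c" by blast
    then have "y \<in> ?B \<union> ?s ` \<Union>C" using partial_subdivisionD(1) by blast
    then show False using y nosing by auto
  qed
  have upB: "b \<in> ?B" if "b \<in> C" "y \<subset> b" for b using up[OF y that(1)] that(2) by blast
  have sy: "?s ` y \<subseteq> ?s ` \<Union>C" using yC by blast
  have sA: "?s ` y \<inter> A = {}" using nosing by blast
  show "partial_subdivision C A = stellar (partial_subdivision C ?B) (?s ` y) y"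
  proof (rule set_eqI)
    fix c
    show "c \<in> partial_subdivision C A \<longleftrightarrow> c \<in> stellar (partial_subdivision C ?B) (?s ` y) y"
      unfolding mem_stellar_iff[OF w]
    proof (cases "y \<in> c")
      case False
      then have e: "c - ?B = c - A" "c \<inter> ?B = c \<inter> A" by blast+
      \<comment> \<open>For simplices avoiding \<open>y\<close>, the two sides could disagree only
        when the old vertices span exactly \<open>y\<close>; by up-closedness any larger span lies
        in \<open>A - {y}\<close> and is excluded on both sides.\<close>
      have "\<not> ?s ` y \<subseteq> c \<longleftrightarrow> \<Union>(c - A) \<noteq> y" if c: "c \<subseteq> A \<union> ?s ` \<Union>C" "\<Union>(c - A) \<in> C - ?B"
      proof
        assume n: "\<not> ?s ` y \<subseteq> c"
        show "\<Union>(c - A) \<noteq> y"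
        proof
          assume u: "\<Union>(c - A) = y"
          have "{v} \<in> c" if v: "v \<in> y" for v
          proof -
            obtain t where "t \<in> c - A" "v \<in> t" using u v by blast
            moreover then obtain u where "t = {u}" using c(1) by blast
            ultimately show ?thesis by simp
          qed
          then show False using n by blast
        qed
      next
        assume n: "\<Union>(c - A) \<noteq> y"
        show "\<not> ?s ` y \<subseteq> c"
        proof
          assume "?s ` y \<subseteq> c"
          then have "y \<subseteq> \<Union>(c - A)" using sA by blast
          then show False using upB[of "\<Union>(c - A)"] c(2) n by blast
        qed
      qed
      then show "c \<in> partial_subdivision C A \<longleftrightarrow>
        (if y \<in> c then c - {y} \<union> ?s ` y \<in> partial_subdivision C ?B \<and> \<not> ?s ` y \<subseteq> c
         else c \<in> partial_subdivision C ?B \<and> \<not> ?s ` y \<subseteq> c)"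
        using False y unfolding partial_subdivision_def mem_Collect_eq e by auto
    next
      case True
      let ?d = "c - {y} \<union> ?s ` y"
      have e: "?d - ?B = (c - A) \<union> ?s ` y" using y sA by blast
      have Ue: "\<Union>(?d - ?B) = \<Union>(c - A) \<union> y" unfolding e by blast
      have ysing: "\<not> y \<subseteq> {v}" for v
      proof
        assume "y \<subseteq> {v}"
        then have "card y \<le> card {v}" by (intro card_mono) auto
        then show False using y A by auto
      qed
      have "c \<in> partial_subdivision C A \<longleftrightarrow> ?d \<in> partial_subdivision C ?B \<and> \<not> ?s ` y \<subseteq> c"
      proof
        assume "c \<in> partial_subdivision C A"
        note c = partial_subdivisionD[OF this]
        have sub: "t \<subseteq> y" if t: "t \<in> c - A" for t
        proof -
          obtain v where "t = {v}" using t c(1) by blast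
          moreover have "y \<subseteq> t \<or> t \<subseteq> y" using c(2) True y t by blast
          ultimately show ?thesis using ysing by blast
        qed
        then have "\<Union>(c - A) \<subseteq> y" by blast
        moreover have "\<Union>(c - A) \<noteq> y" using c(3) y by blast
        moreover have "y \<subseteq> \<Union>(c - A)" if "?s ` y \<subseteq> c" using that sA by blast
        ultimately have "\<not> ?s ` y \<subseteq> c" by blast
        moreover have "\<Union>(?d - ?B) \<in> C - ?B" unfolding Ue using \<open>\<Union>(c - A) \<subseteq> y\<close> yC by (simp add: Un_absorb1)
        moreover have "?d \<subseteq> ?B \<union> ?s ` \<Union>C" using c(1) sy by blast
        moreover have "a \<subseteq> t \<or> t \<subseteq> a" if a: "a \<in> ?d \<inter> ?B" and t: "t \<in> ?d" for a t
        proof (cases "t \<in> c")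
          case True
          then show ?thesis using a c(2) nosing by blast
        next
          case False
          then obtain v where v: "t = {v}" "v \<in> y" using t by blast
          have "a \<in> c \<inter> A" "a \<noteq> y" using a sA by blast+
          then have "a \<subseteq> y \<or> y \<subseteq> a" using c(2)[rule_format, of a y] True by simp
          then have "y \<subseteq> a" using min[of a] \<open>a \<in> c \<inter> A\<close> by blast
          then show ?thesis using v by blast
        qed
        ultimately show "?d \<in> partial_subdivision C ?B \<and> \<not> ?s ` y \<subseteq> c"
          by (intro conjI partial_subdivisionI)
      next
        assume "?d \<in> partial_subdivision C ?B \<and> \<not> ?s ` y \<subseteq> c"
        then have dB: "?d \<in> partial_subdivision C ?B" and ns: "\<not> ?s ` y \<subseteq> c" by simp_all
        note d = partial_subdivisionD[OF dB]
        have Uy: "\<Union>(c - A) \<subseteq> y"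
        proof -
          have "\<Union>(c - A) \<union> y \<in> C - ?B" using d(3) unfolding Ue .
          then show ?thesis using upB[of "\<Union>(c - A) \<union> y"] by blast
        qed
        have cA: "c \<subseteq> A \<union> ?s ` \<Union>C" using d(1) y by blast
        have "\<Union>(c - A) \<noteq> y"
        proof
          assume u: "\<Union>(c - A) = y"
          have "{v} \<in> c" if v: "v \<in> y" for v
          proof -
            obtain t where "t \<in> c - A" "v \<in> t" using u v by blast
            moreover then obtain u where "t = {u}" using cA by blast
            ultimately show ?thesis by simp
          qed
          then show False using ns by blast
        qed
        then have "\<Union>(c - A) \<notin> A" using Uy min[of "\<Union>(c - A)"] by blast
        moreover have "\<Union>(c - A) \<in> C" using acomplex_down[OF C yC Uy] .
        \<comment> \<open>\<open>a\<close> is comparable with each singleton of \<open>y\<close>;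
          having at least two elements, it must contain that singleton.\<close>
        moreover have ya: "y \<subseteq> a" if "a \<in> c \<inter> ?B" for a
        proof
          fix v assume v: "v \<in> y"
          have "a \<in> ?d \<inter> ?B" "{v} \<in> ?d" using that v by blast+
          then have "a \<subseteq> {v} \<or> {v} \<subseteq> a" by (rule d(2)[rule_format])
          moreover have "\<not> a \<subseteq> {v}"
          proof
            assume "a \<subseteq> {v}"
            then have "card a \<le> card {v}" by (intro card_mono) auto
            then show False using that A by auto
          qed
          ultimately show "v \<in> a" by blast
        qed
        moreover have "a \<subseteq> t \<or> t \<subseteq> a" if a: "a \<in> c \<inter> A" and t: "t \<in> c" for a t
        proof (cases "a = y")
          case True
          show ?thesis
          proof (cases "t \<in> A")
            case True
            then show ?thesis using ya[of t] t \<open>a = y\<close> by (cases "t = y") auto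
          next
            case False
            then show ?thesis using Uy t \<open>a = y\<close> by blast
          qed
        next
          case False
          then have aB: "a \<in> c \<inter> ?B" using a by blast
          show ?thesis
          proof (cases "t = y")
            case True
            then show ?thesis using ya[OF aB] by simp
          next
            case False
            then have "a \<in> ?d \<inter> ?B" "t \<in> ?d" using aB a t by blast+
            then show ?thesis by (rule d(2)[rule_format])
          qed
        qed
        ultimately show "c \<in> partial_subdivision C A"
          using cA by (intro partial_subdivisionI) simp_all
      qed
      then show "c \<in> partial_subdivision C A \<longleftrightarrow>
        (if y \<in> c then c - {y} \<union> ?s ` y \<in> partial_subdivision C ?B \<and> \<not> ?s ` y \<subseteq> c
         else c \<in> partial_subdivision C ?B \<and> \<not> ?s ` y \<subseteq> c)"
        using True by simp
    qed
  qed
qed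

text \<open>Without a minimal element, \<open>A\<close> is still up-closed, so the last stellar
  subdivision can be split off.\<close>

lemma acontractible_partial_subdivision:
  assumes "acontractible C" "A \<subseteq> {a \<in> C. 2 \<le> card a}" "\<And>a b. a \<in> A \<Longrightarrow> b \<in> C \<Longrightarrow> a \<subseteq> b \<Longrightarrow> b \<in> A"
  shows "acontractible (partial_subdivision C A)"
  using assms
proof (induction "card A" arbitrary: A rule: less_induct)
  case less
  have C: "acomplex C" using less.prems(1) by (rule acontractible_acomplex)
  have fin: "finite A" using less.prems(2) finite_subset[OF _ acomplex_finite[OF C]] by blast
  show ?case
  proof (cases "A = {}")
    case True
    then show ?thesis using less.prems(1) by (simp add: partial_subdivision_empty acontractible_relabel)
  next
    case False
    obtain y where y: "y \<in> A" "\<And>a. a \<in> A \<Longrightarrow> a \<subseteq> y \<Longrightarrow> a = y"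
      using finite_has_minimal[OF fin False] by blast
    have "y \<noteq> {}" using y(1) less.prems(2) by auto
    have IH: "acontractible (partial_subdivision C (A - {y}))"
    proof (rule less.hyps)
      show "card (A - {y}) < card A" using fin y(1) by (rule card_Diff1_less)
      show "b \<in> A - {y}" if "a \<in> A - {y}" "b \<in> C" "a \<subseteq> b" for a b
        using that less.prems(3)[of a b] y(2)[of a] by blast
    qed (use less.prems(1,2) in auto)
    note step = partial_subdivision_step[OF C less.prems(2,3) y]
    have "acontractible (stellar (partial_subdivision C (A - {y})) ((\<lambda>v. {v}) ` y) y)"
      using IH _ step(1) by (rule acontractible_stellar) (use \<open>y \<noteq> {}\<close> in simp)
    then show ?thesis by (simp only: step(2))
  qed
qed

lemma acontractible_barycentric:
  assumes "acontractible C"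
  shows "acontractible (order_complex (C - {{}}))"
proof -
  have C: "acomplex C" using assms by (rule acontractible_acomplex)
  have "acontractible (partial_subdivision C {a \<in> C. 2 \<le> card a})"
  proof (rule acontractible_partial_subdivision[OF assms subset_refl])
    show "b \<in> {a \<in> C. 2 \<le> card a}" if "a \<in> {a \<in> C. 2 \<le> card a}" "b \<in> C" "a \<subseteq> b" for a b
      using that card_mono[OF acomplex_finite_simplex[OF C that(2)] that(3)] by simp
  qed
  then show ?thesis by (simp add: partial_subdivision_all[OF C])
qed

section \<open>Spheres among order complexes\<close>

text \<open>The dimensions of the lower and the upper sphere may vary with \<open>p\<close>; only
  their sum is fixed.\<close>

lemma asphere_usphere_order_complex:
  assumes "finite P"
    and "\<And>p. p \<in> P \<Longrightarrow> \<exists>l m. l + m = n \<and> asphere l (order_complex {y \<in> P. y \<subset> p}) \<and>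
      asphere m (order_complex {y \<in> P. p \<subset> y})"
    and "c \<in> order_complex P" "c \<noteq> {}"
  shows "asphere n (usphere (order_complex P) c)"
proof (rule asphere_usphere_of_vertices[OF acomplex_order_complex[OF assms(1)] _ assms(3,4)])
  fix p assume "{p} \<in> order_complex P"
  then have p: "p \<in> P" by (simp add: order_complex_def)
  obtain l m where lm: "l + m = n" "asphere l (order_complex {y \<in> P. y \<subset> p})"
    "asphere m (order_complex {y \<in> P. p \<subset> y})"
    using assms(2)[OF p] by blast
  show "asphere n (usphere (order_complex P) {p})"
    using asphere_join[OF lm(2,3) disjoint_below_above] lm(1) by (simp add: usphere_order_complex[OF p])
qed

lemma asphere_order_complex:
  assumes "finite P"
    and "\<And>p. p \<in> P \<Longrightarrow> \<exists>l m. l + m = n \<and> asphere l (order_complex {y \<in> P. y \<subset> p}) \<and>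
      asphere m (order_complex {y \<in> P. p \<subset> y})"
    and "p0 \<in> P" "acontractible (order_complex (P - {p0}))"
  shows "asphere (Suc n) (order_complex P)"
proof -
  have "{p0} \<in> order_complex P - {{}}" using assms(3) by (simp add: order_complex_def)
  moreover have "acontractible (deletion (order_complex P) {p0})" using assms(4) by (simp add: deletion_order_complex)
  moreover have "\<forall>c\<in>order_complex P - {{}}. asphere n (usphere (order_complex P) c)"
    using asphere_usphere_order_complex[OF assms(1,2)] by blast
  ultimately show ?thesis using acomplex_order_complex[OF assms(1)] unfolding asphere.simps by blast
qed

section \<open>Intervals and fibers in the lattice of subsets\<close>

text \<open>The interval is the face poset of the boundary of the simplex \<open>b - a\<close>, of
  dimension \<open>card (b - a) - 2\<close>, and the index is one more. The parts below and above an
  element are shorter intervals.\<close>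

lemma asphere_order_complex_interval:
  assumes "finite b" "a \<subset> b"
  shows "asphere (card (b - a) - 1) (order_complex {y. a \<subset> y \<and> y \<subset> b})"
  using assms
proof (induction "card (b - a)" arbitrary: a b rule: less_induct)
  case less
  let ?P = "{y. a \<subset> y \<and> y \<subset> b}"
  obtain v where v: "v \<in> b" "v \<notin> a" using less.prems(2) by blast
  have fP: "finite ?P" using less.prems(1) by (rule finite_subset[rotated, OF finite_Pow_iff[THEN iffD2]]) auto
  have pos: "0 < card (b - a)" using v less.prems(1) by (auto simp: card_gt_0_iff)
  show ?case
  proof (cases "b - a = {v}")
    case True
    then have "b = insert v a" using less.prems(2) by blast
    then have P: "?P = {}" using v by blast
    show ?thesis unfolding P using True by simp
  next
    case False
    then obtain u where u: "u \<in> b" "u \<notin> a" "u \<noteq> v" using v by blast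
    have "card {u, v} \<le> card (b - a)" using u v less.prems(1) by (intro card_mono) auto
    moreover define n where "n = card (b - a) - 2"
    ultimately have n: "card (b - a) = Suc (Suc n)" using u(3) by simp
    have local: "\<exists>l m. l + m = n \<and> asphere l (order_complex {y \<in> ?P. y \<subset> p}) \<and>
      asphere m (order_complex {y \<in> ?P. p \<subset> y})" if p: "p \<in> ?P" for p
    proof (intro exI conjI)
      have sub: "a \<subset> p" "p \<subset> b" using p by auto
      have "p \<subseteq> b" "a \<subseteq> b" using sub by auto
      then have fin: "finite p" "finite a" using less.prems(1) by (simp_all add: finite_subset)
      have cards: "card (p - a) = card p - card a" "card (b - p) = card b - card p"
        "card (b - a) = card b - card a" "card a < card p" "card p < card b"
        using sub fin less.prems by (auto simp: card_Diff_subset psubset_card_mono psubset_imp_subset)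
      have "{y \<in> ?P. y \<subset> p} = {y. a \<subset> y \<and> y \<subset> p}" "{y \<in> ?P. p \<subset> y} = {y. p \<subset> y \<and> y \<subset> b}"
        using sub by auto
      then show "asphere (card (p - a) - 1) (order_complex {y \<in> ?P. y \<subset> p})"
        "asphere (card (b - p) - 1) (order_complex {y \<in> ?P. p \<subset> y})"
        using less.hyps[of p a] less.hyps[of b p] cards fin sub less.prems(1) by simp_all
      show "card (p - a) - 1 + (card (b - p) - 1) = n" using cards n by linarith
    qed
    have bv: "b - {v} \<in> ?P" using u v less.prems(2) by blast
    \<comment> \<open>Among the elements of the interval only \<open>b - {v}\<close> becomes
      \<open>b\<close> when \<open>v\<close> is added. Once it is removed, \<open>insert v\<close>
      is a self-map, and its image has the least element \<open>insert v a\<close>.\<close>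
    have act: "acontractible (order_complex (?P - {b - {v}}))"
    proof (rule acontractible_order_complex_retract[where f = "insert v"])
      show "insert v ` (?P - {b - {v}}) \<subseteq> ?P - {b - {v}}" using v by auto
      show "acontractible (order_complex (insert v ` (?P - {b - {v}})))"
      proof (rule acontractible_order_complex_cone[of _ "insert v a"])
        have "insert v a \<in> ?P - {b - {v}}" using u v less.prems(2) by blast
        then have "insert v (insert v a) \<in> insert v ` (?P - {b - {v}})" by (rule imageI)
        then show "insert v a \<in> insert v ` (?P - {b - {v}})" by simp
      qed (use fP in auto)
    qed (use fP in auto)
    have "card (b - a) - 1 = Suc n" using n by simp
    then show ?thesis using asphere_order_complex[OF fP local bv act] by (simp only:)
  qed
qed

text \<open>This poset consists of the proper faces of the product of the simplices \<open>b \<inter> g -` {i}\<close>, \<open>i \<in> K\<close>.\<close>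

lemma asphere_order_complex_fiber:
  assumes "finite b" "g ` b = K"
  shows "asphere (card b - card K) (order_complex {y. y \<subset> b \<and> g ` y = K})"
  using assms
proof (induction "card b" arbitrary: b rule: less_induct)
  case less
  let ?P = "{y. y \<subset> b \<and> g ` y = K}"
  have fP: "finite ?P" using less.prems(1) by (rule finite_subset[rotated, OF finite_Pow_iff[THEN iffD2]]) auto
  have Kb: "card K \<le> card b" using less.prems card_image_le by blast
  show ?case
  proof (cases "inj_on g b")
    case True
    \<comment> \<open>If \<open>g\<close> is injective on \<open>b\<close>, no proper subset has the
      full image; then \<open>card b = card K\<close>, and index 0 stands for the void
      sphere.\<close>
    have P: "?P = {}" using True less.prems(2) by (auto simp: inj_on_image_eq_iff)
    show ?thesis unfolding P using card_image[OF True] less.prems(2) by simp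
  next
    case False
    then obtain u v where uv: "u \<in> b" "v \<in> b" "u \<noteq> v" "g u = g v" by (auto simp: inj_on_def)
    have "card K \<noteq> card b" using False less.prems eq_card_imp_inj_on by blast
    then obtain n where n: "card b - card K = Suc n" using Kb by (metis Suc_diff_Suc le_neq_implies_less)
    have local: "\<exists>l m. l + m = n \<and> asphere l (order_complex {y \<in> ?P. y \<subset> p}) \<and>
      asphere m (order_complex {y \<in> ?P. p \<subset> y})" if p: "p \<in> ?P" for p
    proof (intro exI conjI)
      have sub: "p \<subset> b" "g ` p = K" using p by auto
      have fin: "finite p" using sub less.prems(1) finite_subset by blast
      have cards: "card (b - p) = card b - card p" "card p < card b" "card K \<le> card p"
        using sub fin less.prems card_image_le[of p g]
        by (auto simp: card_Diff_subset psubset_card_mono psubset_imp_subset)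
      have "{y \<in> ?P. y \<subset> p} = {y. y \<subset> p \<and> g ` y = K}" using sub by auto
      then show "asphere (card p - card K) (order_complex {y \<in> ?P. y \<subset> p})"
        using less.hyps[of p] cards fin sub by simp
      \<comment> \<open>Above \<open>p\<close> the image is full automatically, so the upper part is
        an interval.\<close>
      have "{y \<in> ?P. p \<subset> y} = {y. p \<subset> y \<and> y \<subset> b}" using sub less.prems(2) by blast
      then show "asphere (card (b - p) - 1) (order_complex {y \<in> ?P. p \<subset> y})"
        using asphere_order_complex_interval[OF less.prems(1) sub(1)] by simp
      show "card p - card K + (card (b - p) - 1) = n" using cards n by linarith
    qed
    have bv: "b - {v} \<in> ?P"
    proof -
      have "g v \<in> g ` (b - {v})" by (rule image_eqI[where x = u]) (use uv in auto)
      then have "g ` (b - {v}) = g ` b" using uv(2) by blast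
      then show ?thesis using uv(2) less.prems(2) by auto
    qed
    have act: "acontractible (order_complex (?P - {b - {v}}))"
    proof (rule acontractible_order_complex_retract[where f = "insert v"])
      have gv: "g v \<in> K" using uv less.prems(2) by blast
      show "insert v ` (?P - {b - {v}}) \<subseteq> ?P - {b - {v}}" using uv(2) gv by auto
      have img: "insert v ` (?P - {b - {v}}) = {y \<in> ?P. v \<in> y}" (is "_ = ?M")
      proof (intro equalityI subsetI)
        fix y assume "y \<in> insert v ` (?P - {b - {v}})"
        then show "y \<in> ?M" using uv(2) gv by auto
      next
        fix y assume y: "y \<in> ?M"
        then have "y \<in> ?P - {b - {v}}" "y = insert v y" by auto
        then show "y \<in> insert v ` (?P - {b - {v}})" by blast
      qed
      define D where "D = {t \<in> b. g t = g v \<and> t \<noteq> v}"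
      have vD: "v \<notin> D" and uD: "u \<in> D" using uv by (auto simp: D_def)
      have keep: "g ` (y - D) = g ` y" if v: "v \<in> y" for y
      proof -
        have "g t \<in> g ` (y - D)" if "t \<in> y" for t
        proof (cases "t \<in> D")
          case True
          then have "g t = g v" by (simp add: D_def)
          then show ?thesis using v vD by auto
        qed (use that in auto)
        then show ?thesis by blast
      qed
      have bD: "b - D \<in> ?M" using keep[OF uv(2)] uv uD vD less.prems(2) by auto
      have fM: "finite ?M" using fP by (rule finite_subset[rotated]) auto
      have "acontractible (order_complex ?M)"
      proof (rule acontractible_order_complex_retract[where f = "\<lambda>y. y - D"])
        show "(\<lambda>y. y - D) ` ?M \<subseteq> ?M" using keep vD by auto
        show "acontractible (order_complex ((\<lambda>y. y - D) ` ?M))"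
        proof (rule acontractible_order_complex_cone[of _ "b - D"])
          have "b - D - D \<in> (\<lambda>y. y - D) ` ?M" using bD by (rule imageI)
          then show "b - D \<in> (\<lambda>y. y - D) ` ?M" by simp
        qed (use fM in auto)
      qed (use fM in auto)
      then show "acontractible (order_complex (insert v ` (?P - {b - {v}})))" by (simp only: img)
    qed (use fP in auto)
    have "card b - card K = Suc n" using n by simp
    then show ?thesis using asphere_order_complex[OF fP local bv act] by (simp only:)
  qed
qed

text \<open>The order complex of the face poset without \<open>z\<close> arises from the barycentric subdivision of the
  deletion of \<open>z\<close> by adding the faces \<open>y \<supset> z\<close> in order of decreasing size; when \<open>y\<close> is added, the
  faces below it not containing \<open>z\<close> retract to the faces that contain a fixed vertex of \<open>y - z\<close>.\<close>

lemma acontractible_punctured_barycentric: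
  assumes Q: "acomplex Q" and z: "z \<in> Q" "z \<noteq> {}" and "acontractible (deletion Q z)"
  shows "acontractible (order_complex (Q - {{}} - {z}))"
proof -
  have "acontractible (order_complex (deletion Q z - {{}} \<union> A))"
    if "A \<subseteq> {y \<in> Q. z \<subset> y}" "\<And>a b. a \<in> A \<Longrightarrow> b \<in> Q \<Longrightarrow> a \<subseteq> b \<Longrightarrow> b \<in> A" for A
    using that
  proof (induction "card A" arbitrary: A rule: less_induct)
    case less
    have fin: "finite A" using less.prems(1) finite_subset[OF _ acomplex_finite[OF Q]] by blast
    show ?case
    proof (cases "A = {}")
      case True
      then show ?thesis using acontractible_barycentric[OF assms(4)] by simp
    next
      case False
      obtain y where y: "y \<in> A" "\<And>a. a \<in> A \<Longrightarrow> a \<subseteq> y \<Longrightarrow> a = y"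
        using finite_has_minimal[OF fin False] by blast
      have yQ: "y \<in> Q" "z \<subset> y" using y(1) less.prems(1) by auto
      let ?P = "deletion Q z - {{}} \<union> A"
      have fP: "finite ?P" using fin acomplex_finite[OF Q] deletion_subset[of Q z] finite_subset by blast
      obtain v where v: "v \<in> y" "v \<notin> z" using yQ by blast
      have below: "{w \<in> ?P. w \<subset> y} = {w. w \<noteq> {} \<and> w \<subset> y \<and> \<not> z \<subseteq> w}" (is "_ = ?B")
      proof (intro equalityI subsetI)
        fix w assume w: "w \<in> {w \<in> ?P. w \<subset> y}"
        then have "w \<notin> A" using y(2)[of w] by blast
        then show "w \<in> ?B" using w by (simp add: mem_deletion)
      next
        fix w assume w: "w \<in> ?B"
        then have "w \<in> Q" using acomplex_down[OF Q yQ(1), of w] by blast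
        then show "w \<in> {w \<in> ?P. w \<subset> y}" using w by (simp add: mem_deletion)
      qed
      have fB: "finite ?B" using fP below by (metis (no_types, lifting) finite_subset mem_Collect_eq subsetI)
      have "acontractible (order_complex ?B)"
      proof (rule acontractible_order_complex_retract[where f = "insert v"])
        \<comment> \<open>Adding \<open>v\<close> cannot complete \<open>z\<close>, as
          \<open>v \<notin> z\<close>, nor fill up \<open>y\<close>, since a set missing at most
          \<open>v\<close> from \<open>y\<close> would already contain \<open>z\<close>.\<close>
        show "insert v ` ?B \<subseteq> ?B" using v yQ by auto
        show "acontractible (order_complex (insert v ` ?B))"
        proof (rule acontractible_order_complex_cone[of _ "{v}"])
          have "{v} \<in> ?B" using v yQ z(2) by auto
          then have "insert v {v} \<in> insert v ` ?B" by (rule imageI)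
          then show "{v} \<in> insert v ` ?B" by simp
        qed (use fB in auto)
      qed (use fB in auto)
      moreover have "acontractible (order_complex (deletion Q z - {{}} \<union> (A - {y})))"
      proof (rule less.hyps)
        show "card (A - {y}) < card A" using fin y(1) by (rule card_Diff1_less)
        show "A - {y} \<subseteq> {y \<in> Q. z \<subset> y}" using less.prems(1) by blast
        show "b \<in> A - {y}" if "a \<in> A - {y}" "b \<in> Q" "a \<subseteq> b" for a b
          using that less.prems(2)[of a b] y(2)[of a] by blast
      qed
      moreover have "?P - {y} = deletion Q z - {{}} \<union> (A - {y})"
        using yQ by (auto simp: mem_deletion)
      ultimately show ?thesis
        using acontractible_order_complex_remove[OF fP, of y] y(1) below by simp
    qed
  qed
  from this[of "{y \<in> Q. z \<subset> y}"]
  have "acontractible (order_complex (deletion Q z - {{}} \<union> {y \<in> Q. z \<subset> y}))" by blast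
  moreover have "deletion Q z - {{}} \<union> {y \<in> Q. z \<subset> y} = Q - {{}} - {z}"
    using z(2) by (auto simp: mem_deletion)
  ultimately show ?thesis by simp
qed

lemma order_complex_translate:
  assumes "\<And>z. z \<in> P \<Longrightarrow> x \<inter> z = {}"
  shows "order_complex ((\<union>) x ` P) = (`) ((\<union>) x) ` order_complex P"
proof -
  have le: "x \<union> a \<subseteq> x \<union> b \<longleftrightarrow> a \<subseteq> b" if "a \<in> P" "b \<in> P" for a b using assms that by blast
  show ?thesis
  proof (intro equalityI subsetI)
    fix c assume "c \<in> order_complex ((\<union>) x ` P)"
    then have c: "c \<subseteq> (\<union>) x ` P" "\<And>a b. a \<in> c \<Longrightarrow> b \<in> c \<Longrightarrow> a \<subseteq> b \<or> b \<subseteq> a"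
      by (auto simp: order_complex_def)
    obtain d where d: "d \<subseteq> P" "c = (\<union>) x ` d" using c(1) by (auto simp: subset_image_iff)
    have "a \<subseteq> b \<or> b \<subseteq> a" if "a \<in> d" "b \<in> d" for a b
    proof -
      have "x \<union> a \<subseteq> x \<union> b \<or> x \<union> b \<subseteq> x \<union> a" by (rule c(2)) (use that d(2) in auto)
      then show ?thesis using le d(1) that by blast
    qed
    then have "d \<in> order_complex P" using d(1) by (simp add: order_complex_def)
    then show "c \<in> (`) ((\<union>) x) ` order_complex P" using d(2) by blast
  next
    fix c assume "c \<in> (`) ((\<union>) x) ` order_complex P"
    then show "c \<in> order_complex ((\<union>) x ` P)" unfolding order_complex_def by blast
  qed
qed

text \<open>This is the face poset of \<open>Q\<close> shifted by \<open>x\<close>. Keeping the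
  shift in the statement makes the part above \<open>p = x \<union> z\<close> an instance of the
  same form, with \<open>p\<close> for \<open>x\<close> and the link of \<open>z\<close> for
  \<open>Q\<close>, so the induction applies directly; the part below is an interval.\<close>

lemma asphere_order_complex_above:
  assumes "asphere n Q" "finite x" "x \<inter> \<Union>Q = {}"
  shows "asphere n (order_complex ((\<union>) x ` (Q - {{}})))"
  using assms
proof (induction n arbitrary: Q x rule: less_induct)
  case (less n)
  have Q: "acomplex Q" using less.prems(1) by (rule asphere_acomplex)
  show ?case
  proof (cases n)
    case 0
    then show ?thesis using less.prems(1) by simp
  next
    case (Suc k)
    let ?P = "(\<union>) x ` (Q - {{}})"
    have fP: "finite ?P" using acomplex_finite[OF Q] by simp
    have dis: "x \<inter> z = {}" if "z \<in> Q" for z using that less.prems(3) by blast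
    have "\<exists>l m. l + m = k \<and> asphere l (order_complex {y \<in> ?P. y \<subset> p}) \<and>
      asphere m (order_complex {y \<in> ?P. p \<subset> y})" if p: "p \<in> ?P" for p
    proof -
      obtain z where z: "z \<in> Q" "z \<noteq> {}" "p = x \<union> z" using p by auto
      have fz: "finite z" using z(1) acomplex_finite_simplex[OF Q] by blast
      have cz: "0 < card z" "card z \<le> n" using fz z(2) asphere_link(1)[OF less.prems(1) z(1)]
        by (auto simp: card_gt_0_iff)
      have "{y \<in> ?P. y \<subset> p} = {y. x \<subset> y \<and> y \<subset> p}"
      proof (intro equalityI subsetI)
        fix y assume "y \<in> {y \<in> ?P. y \<subset> p}"
        then show "y \<in> {y. x \<subset> y \<and> y \<subset> p}" using dis by auto
      next
        fix y assume y: "y \<in> {y. x \<subset> y \<and> y \<subset> p}"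
        then have "y - x \<subseteq> z" "y - x \<noteq> {}" "y = x \<union> (y - x)" using z(3) by auto
        moreover then have "y - x \<in> Q" using acomplex_down[OF Q z(1)] by blast
        ultimately show "y \<in> {y \<in> ?P. y \<subset> p}" using y by blast
      qed
      moreover have "p - x = z" "x \<subset> p" "finite p" using z dis[OF z(1)] fz less.prems(2) by auto
      ultimately have lower: "asphere (card z - 1) (order_complex {y \<in> ?P. y \<subset> p})"
        using asphere_order_complex_interval[of p x] by simp
      have "{y \<in> ?P. p \<subset> y} = (\<union>) p ` (link Q z - {{}})"
      proof (intro equalityI subsetI)
        fix y assume "y \<in> {y \<in> ?P. p \<subset> y}"
        then obtain w where w: "w \<in> Q" "y = x \<union> w" "p \<subset> y" by auto
        have "z \<subset> w" using w z(3) dis[OF z(1)] by blast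
        then have "w - z \<union> z = w" by blast
        then have "w - z \<in> link Q z - {{}}" "y = p \<union> (w - z)"
          using w z(3) \<open>z \<subset> w\<close> by (auto simp: link_def)
        then show "y \<in> (\<union>) p ` (link Q z - {{}})" by blast
      next
        fix y assume "y \<in> (\<union>) p ` (link Q z - {{}})"
        then obtain w where w: "y = p \<union> w" "w \<inter> z = {}" "w \<union> z \<in> Q" "w \<noteq> {}" by (auto simp: link_def)
        have "y = x \<union> (w \<union> z)" using w(1) z(3) by blast
        moreover have "w \<inter> x = {}" using dis[OF w(3)] by blast
        ultimately show "y \<in> {y \<in> ?P. p \<subset> y}" using w z(3) by auto
      qed
      moreover have "asphere (n - card z) (order_complex ((\<union>) p ` (link Q z - {{}})))"
      proof (rule less.IH)
        show "n - card z < n" using cz by linarith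
        show "asphere (n - card z) (link Q z)" by (rule asphere_link(2)[OF less.prems(1) z(1)])
        show "finite p" using z(3) fz less.prems(2) by simp
        show "p \<inter> \<Union>(link Q z) = {}"
        proof -
          have "p \<inter> w = {}" if "w \<in> link Q z" for w
            using that z(3) dis[of "w \<union> z"] by (auto simp: link_def)
          then show ?thesis by blast
        qed
      qed
      ultimately have "asphere (n - card z) (order_complex {y \<in> ?P. p \<subset> y})" by simp
      moreover have "card z - 1 + (n - card z) = k" using cz Suc by linarith
      ultimately show ?thesis using lower by blast
    qed
    moreover obtain z where z: "z \<in> Q" "z \<noteq> {}" "acontractible (deletion Q z)"
      using less.prems(1) Suc by auto
    have zP: "x \<union> z \<in> ?P" using z by blast
    moreover have "acontractible (order_complex (?P - {x \<union> z}))"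
    proof -
      let ?R = "Q - {{}} - {z}"
      \<comment> \<open>Undoing the shift, a mere relabelling of vertices, reduces the claim to the
        punctured face poset of \<open>Q\<close>.\<close>
      have inj: "inj_on ((\<union>) x) (Q - {{}})" using dis by (intro inj_onI) blast
      have "?P - {x \<union> z} = (\<union>) x ` ?R" using inj_on_image_set_diff[OF inj, of "Q - {{}}" "{z}"] z by simp
      moreover have "order_complex ((\<union>) x ` ?R) = (`) ((\<union>) x) ` order_complex ?R"
        by (rule order_complex_translate) (use dis in auto)
      moreover have "inj_on ((\<union>) x) (\<Union>(order_complex ?R))"
        by (rule inj_on_subset[OF inj]) (use Union_order_complex[of ?R] in blast)
      ultimately show ?thesis using acontractible_relabel[OF acontractible_punctured_barycentric[OF Q z]] by simp
    qed
    ultimately show ?thesis using asphere_order_complex[OF fP] Suc by blast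
  qed
qed

section \<open>Manifolds\<close>

lemma simplicial_complex_iff: "simplicial_complex G \<longleftrightarrow> acomplex (insert {} G) \<and> {} \<notin> G"
proof
  assume G: "simplicial_complex G"
  then have "acomplex (insert {} G)"
    by (intro acomplexI) (auto simp: simplicial_complex_def)
  then show "acomplex (insert {} G) \<and> {} \<notin> G" using G by (auto simp: simplicial_complex_def)
next
  assume G: "acomplex (insert {} G) \<and> {} \<notin> G"
  then have "finite x \<and> x \<noteq> {}" if "x \<in> G" for x
    using that acomplex_finite_simplex[of "insert {} G" x] by auto
  moreover have "y \<in> G" if "x \<in> G" "y \<subseteq> x" "y \<noteq> {}" for x y
    using G acomplex_down[of "insert {} G" x y] that by simp
  ultimately show "simplicial_complex G"
    using G acomplex_finite[of "insert {} G"] unfolding simplicial_complex_def by simp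
qed

lemma unit_sphere_eq:
  assumes "simplicial_complex G" "x \<in> G"
  shows "unit_sphere G x = usphere (insert {} G) x - {{}}"
proof -
  have x: "x \<noteq> {}" using assms by (auto simp: simplicial_complex_def)
  have down: "y \<in> G" if "z \<in> G" "y \<subseteq> z" "y \<noteq> {}" for y z
    using assms(1) that unfolding simplicial_complex_def by blast
  show ?thesis
  proof (intro equalityI subsetI)
    fix z assume "z \<in> unit_sphere G x"
    then obtain y where y: "z \<noteq> {}" "y \<in> G" "x \<subseteq> y" "z \<subseteq> y" "z \<notin> star G x"
      by (auto simp: unit_sphere_def simplicial_closure_def star_def)
    have "z \<in> G" using down[OF y(2,4,1)] .
    then have "\<not> x \<subseteq> z" using y(5) by (simp add: star_def)
    moreover have "z \<union> x \<in> G" using down[OF y(2), of "z \<union> x"] y x by auto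
    ultimately show "z \<in> usphere (insert {} G) x - {{}}" using y(1) by (simp add: mem_usphere)
  next
    fix z assume "z \<in> usphere (insert {} G) x - {{}}"
    then have z: "\<not> x \<subseteq> z" "z \<union> x \<in> G" "z \<noteq> {}" using x by (auto simp: mem_usphere)
    then have "z \<in> simplicial_closure (star G x)"
      by (auto simp: simplicial_closure_def star_def)
    then show "z \<in> unit_sphere G x" using z by (simp add: unit_sphere_def star_def)
  qed
qed

lemma insert_unit_sphere:
  assumes "simplicial_complex G" "x \<in> G"
  shows "insert {} (unit_sphere G x) = usphere (insert {} G) x"
proof -
  have "x \<noteq> {}" using assms by (auto simp: simplicial_complex_def)
  then have "{} \<in> usphere (insert {} G) x" using assms(2) by (simp add: mem_usphere)
  then show ?thesis unfolding unit_sphere_eq[OF assms] by blast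
qed

lemma insert_minus_star:
  assumes "simplicial_complex G" "x \<in> G"
  shows "insert {} (G - star G x) = deletion (insert {} G) x"
proof -
  have "x \<noteq> {}" using assms by (auto simp: simplicial_complex_def)
  then show ?thesis by (auto simp: star_def deletion_def)
qed

lemma contractible_complex_iff: "contractible_complex G \<longleftrightarrow> acontractible (insert {} G) \<and> {} \<notin> G"
proof
  assume "contractible_complex G"
  then show "acontractible (insert {} G) \<and> {} \<notin> G"
  proof (induction rule: contractible_complex.induct)
    case (one_point v)
    have "insert {} {{v}} = Pow {v}" by auto
    then show ?case by (simp add: single_vertex)
  next
    case (extend G x)
    have G: "{} \<notin> G" "acomplex (insert {} G)" using extend(1) by (simp_all add: simplicial_complex_iff)
    then have "x \<noteq> {}" using extend(2) by blast
    have "acontractible (usphere (insert {} G) x)" "acontractible (deletion (insert {} G) x)"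
      using extend.IH by (simp_all add: insert_unit_sphere[OF extend(1,2)] insert_minus_star[OF extend(1,2)])
    then have "acontractible (insert {} G)" using extend(2) \<open>x \<noteq> {}\<close> by (intro remove_star[OF G(2), of x]) simp_all
    then show ?case using G(1) by simp
  qed
next
  \<comment> \<open>Phrased with \<open>K - {{}}\<close> so that the induction runs over an
    arbitrary \<open>K\<close> instead of the compound term \<open>insert {} G\<close>.\<close>
  have "contractible_complex (K - {{}})" if "acontractible K" for K :: "'a set set"
    using that
  proof (induction rule: acontractible.induct)
    case (single_vertex v)
    have "Pow {v} - {{}} = {{v}}" by auto
    then show ?case by (simp add: one_point)
  next
    case (remove_star K x)
    have K: "insert {} (K - {{}}) = K" using acomplex_empty[OF remove_star(1)] by blast
    then have s: "simplicial_complex (K - {{}})" using remove_star(1) by (simp add: simplicial_complex_iff)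
    have x: "x \<in> K - {{}}" using remove_star(2,3) by simp
    have "unit_sphere (K - {{}}) x = usphere K x - {{}}"
      using unit_sphere_eq[OF s x] K by simp
    moreover have "(K - {{}}) - star (K - {{}}) x = deletion K x - {{}}"
      by (auto simp: star_def deletion_def)
    ultimately show ?case using extend[OF s x] remove_star.IH by simp
  qed
  then have "acontractible (insert {} G) \<Longrightarrow> contractible_complex (insert {} G - {{}})" .
  moreover assume "acontractible (insert {} G) \<and> {} \<notin> G"
  ultimately show "contractible_complex G" by simp
qed

lemma manifold_iff:
  "manifold q G \<longleftrightarrow> 0 \<le> q \<and> simplicial_complex G \<and> (\<forall>x\<in>G. sphere_complex (q - 1) (unit_sphere G x))"
  by (subst manifold.simps) simp

text \<open>Index \<open>n\<close> means dimension \<open>n - 1\<close>; at \<open>n = 0\<close> the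
  rule for non-negative dimensions cannot apply, and only the void remains.\<close>

lemma sphere_complex_iff_asphere:
  "sphere_complex (int n - 1) G \<longleftrightarrow> asphere n (insert {} G) \<and> {} \<notin> G"
proof (induction n arbitrary: G)
  case 0
  have "sphere_complex (- 1) G \<longleftrightarrow> G = {}" by (subst sphere_complex.simps) simp
  then show ?case by auto
next
  case (Suc n)
  have "sphere_complex (int n) G \<longleftrightarrow>
    manifold (int n) G \<and> (\<exists>x\<in>G. contractible_complex (G - star G x))"
    by (subst sphere_complex.simps) simp
  also have "\<dots> \<longleftrightarrow> asphere (Suc n) (insert {} G) \<and> {} \<notin> G"
  proof (cases "simplicial_complex G")
    case True
    then have nG: "{} \<notin> G" "acomplex (insert {} G)" by (simp_all add: simplicial_complex_iff)
    have u: "sphere_complex (int n - 1) (unit_sphere G x) \<longleftrightarrow> asphere n (usphere (insert {} G) x)"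
      if "x \<in> G" for x
    proof -
      have "{} \<notin> unit_sphere G x" unfolding unit_sphere_eq[OF True that] by simp
      then show ?thesis by (simp add: Suc.IH insert_unit_sphere[OF True that])
    qed
    have d: "contractible_complex (G - star G x) \<longleftrightarrow> acontractible (deletion (insert {} G) x)" if "x \<in> G" for x
      unfolding contractible_complex_iff insert_minus_star[OF True that] using nG by simp
    have e: "insert {} G - {{}} = G" using nG by simp
    show ?thesis unfolding manifold_iff asphere.simps e using True nG u d by auto
  next
    case False
    then show ?thesis unfolding manifold_iff asphere.simps by (auto simp: simplicial_complex_iff)
  qed
  finally show ?case by simp
qed

text \<open>No shift is visible here, since the unit spheres of an \<open>n\<close>-manifold have
  dimension \<open>n - 1\<close> and hence index \<open>n\<close>.\<close>

lemma manifold_iff_asphere: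
  "manifold (int n) G \<longleftrightarrow>
    acomplex (insert {} G) \<and> {} \<notin> G \<and> (\<forall>x\<in>G. asphere n (usphere (insert {} G) x))"
proof (cases "simplicial_complex G")
  case True
  have "sphere_complex (int n - 1) (unit_sphere G x) \<longleftrightarrow> asphere n (usphere (insert {} G) x)"
    if "x \<in> G" for x
  proof -
    have "{} \<notin> unit_sphere G x" unfolding unit_sphere_eq[OF True that] by simp
    then show ?thesis by (simp add: sphere_complex_iff_asphere insert_unit_sphere[OF True that])
  qed
  then show ?thesis unfolding manifold_iff using True by (auto simp: simplicial_complex_iff)
next
  case False
  then show ?thesis unfolding manifold_iff by (auto simp: simplicial_complex_iff)
qed

section \<open>The level set\<close>

lemma inclusion_complex_eq:
  assumes "finite M"
  shows "inclusion_complex M = order_complex M - {{}}"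
proof -
  have "(a \<noteq> b \<longrightarrow> a \<subset> b \<or> b \<subset> a) \<longleftrightarrow> a \<subseteq> b \<or> b \<subseteq> a" for a b :: "'a set" by blast
  moreover have "finite c" if "c \<subseteq> M" for c using that assms by (rule finite_subset)
  ultimately show ?thesis
    unfolding inclusion_complex_def whitney_complex_def order_complex_def by auto
qed

theorem mainTheorem11:
  fixes G :: "'a set set" and q :: int and k :: nat and g :: "'a \<Rightarrow> nat"
  assumes "manifold q G"
    and "g \<in> vertices G \<rightarrow> {0..k}"
    and "level_set G g k \<noteq> {}"
  shows "manifold (q - int k) (inclusion_complex (level_set G g k))"
proof -
  let ?M = "level_set G g k" and ?K = "insert {} G"
  have "0 \<le> q" using assms(1) unfolding manifold_iff by simp
  then obtain n where n: "q = int n" using nonneg_int_cases by blast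
  have K: "acomplex ?K" "{} \<notin> G" and S: "\<forall>x\<in>?K - {{}}. asphere n (usphere ?K x)"
    using assms(1) unfolding n manifold_iff_asphere by auto
  have fM: "finite ?M" using acomplex_finite[OF K(1)] by (simp add: level_set_def)
  have M: "p \<in> G" "p \<noteq> {}" "finite p" "g ` p = {0..k}" "Suc k \<le> card p" "card p \<le> Suc n"
    "asphere (Suc n - card p) (link ?K p)" if p: "p \<in> ?M" for p
  proof -
    show *: "p \<in> G" "g ` p = {0..k}" using p by (auto simp: level_set_def)
    then show "p \<noteq> {}" by auto
    show "finite p" using *(1) acomplex_finite_simplex[OF K(1)] by blast
    then show "Suc k \<le> card p" using card_image_le[of p g] *(2) by simp
    have "p \<in> ?K" using *(1) by blast
    note asphere_link_of_usphere[OF K(1) S this]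
    then show "card p \<le> Suc n" "asphere (Suc n - card p) (link ?K p)" using \<open>p \<noteq> {}\<close> by auto
  qed
  \<comment> \<open>A simplex \<open>p\<close> of the level set has at least \<open>k + 1\<close>
    vertices and, in a manifold of dimension \<open>n\<close>, at most \<open>n + 1\<close>. Hence
    the natural number \<open>n - k\<close> agrees with the integer difference in the claim.\<close>
  have kn: "k \<le> n" using assms(3) M(5,6) by fastforce
  \<comment> \<open>The indices are \<open>card p - Suc k\<close> for the lower and
    \<open>Suc n - card p\<close> for the upper sphere; \<open>card p\<close> cancels in the
    sum.\<close>
  have local: "\<exists>l m. l + m = n - k \<and> asphere l (order_complex {y \<in> ?M. y \<subset> p}) \<and>
      asphere m (order_complex {y \<in> ?M. p \<subset> y})" if p: "p \<in> ?M" for p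
  proof (intro exI conjI)
    note Mp = M[OF p]
    have "{y \<in> ?M. y \<subset> p} = {y. y \<subset> p \<and> g ` y = {0..k}}"
    proof -
      have "y \<in> G" if "y \<subset> p" "g ` y = {0..k}" for y
        using acomplex_down[OF K(1), of p y] Mp(1) that by auto
      then show ?thesis by (auto simp: level_set_def)
    qed
    then show "asphere (card p - Suc k) (order_complex {y \<in> ?M. y \<subset> p})"
      using asphere_order_complex_fiber[OF Mp(3,4)] by simp
    have "{y \<in> ?M. p \<subset> y} = (\<union>) p ` (link ?K p - {{}})"
    proof (intro equalityI subsetI)
      fix y assume "y \<in> {y \<in> ?M. p \<subset> y}"
      then have y: "y \<in> G" "p \<subset> y" by (auto simp: level_set_def)
      then have "y - p \<union> p = y" by blast
      then have "y - p \<in> link ?K p - {{}}" using y by (auto simp: link_def)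
      moreover have "y = p \<union> (y - p)" using y by blast
      ultimately show "y \<in> (\<union>) p ` (link ?K p - {{}})" by blast
    next
      fix y assume "y \<in> (\<union>) p ` (link ?K p - {{}})"
      then obtain w where w: "y = p \<union> w" "w \<inter> p = {}" "w \<union> p \<in> ?K" "w \<noteq> {}" by (auto simp: link_def)
      then have y: "y \<in> G" "p \<subset> y" by (auto simp: Un_commute)
      \<comment> \<open>Since \<open>g\<close> takes values in \<open>{0..k}\<close> only, every
        simplex above \<open>p\<close> stays in the level set, so the whole link of \<open>p\<close>
        appears.\<close>
      have "g ` y \<subseteq> {0..k}" using assms(2) y(1) unfolding vertices_def by blast
      moreover have "{0..k} \<subseteq> g ` y" using Mp(4) y(2) by blast
      ultimately show "y \<in> {y \<in> ?M. p \<subset> y}" using y by (auto simp: level_set_def)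
    qed
    moreover have "p \<inter> \<Union>(link ?K p) = {}" by (auto simp: link_def)
    ultimately show "asphere (Suc n - card p) (order_complex {y \<in> ?M. p \<subset> y})"
      using asphere_order_complex_above[OF Mp(7,3)] by simp
    show "card p - Suc k + (Suc n - card p) = n - k" using Mp(5,6) by linarith
  qed
  have e: "insert {} (inclusion_complex ?M) = order_complex ?M"
    using inclusion_complex_eq[OF fM] acomplex_empty[OF acomplex_order_complex[OF fM]] by blast
  have "manifold (int (n - k)) (inclusion_complex ?M)"
    unfolding manifold_iff_asphere e
    using acomplex_order_complex[OF fM] asphere_usphere_order_complex[OF fM local]
    by (auto simp: inclusion_complex_eq[OF fM])
  then show ?thesis using kn n by simp
qed

end
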